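(* Let $G$ be a strongly critical graph. Then (i) every minimum vertex cover of $G$ is an independent set; in particular, $G$ is bipartite; and (ii) if $G$ has a cutvertex, then $G$ is a special tree.
   Context: All graphs are finite and simple. A vertex cover of $G$ is a set $C \subseteq V(G)$ meeting every edge; $\tau(G)$ is the minimum size of a vertex cover, and a minimum vertex cover is one of size $\tau(G)$. A connected vertex cover of $G$ is a vertex cover $C$ such that $G[C]$ is connected (if $G$ is disconnected, $G[C]$ must have the same number of connected components as $G$); $\tau_c(G)$ is its minimum size. The price of connectivity of a graph $G$ with at least one edge is $\tau_c(G)/\tau(G)$. A graph $G$ is strongly critical if the price of connectivity of every proper (not necessarily induced) subgraph of $G$ is strictly smaller than that of $G$. A tree $T$ is special if it is obtained from some tree by subdividing each edge exactly once and then attaching one new pendant vertex to every leaf of the resulting tree. *)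

theory Defs
  imports Complex_Main "Graph_Theory.Graph_Theory"
begin

text \<open>
  A finite simple graph is a \<^locale>\<open>pair_graph\<close>: finite, loop-free, with a symmetric arc
  relation, so that an undirected edge \<open>{u, v}\<close> is the pair of arcs \<open>(u, v)\<close>, \<open>(v, u)\<close>. The
  strongly connected components of such a digraph are the connected components of the graph.
\<close>

abbreviation (input) graph_components :: "('a, 'b) pre_digraph \<Rightarrow> 'a set set" where
  "graph_components G \<equiv> pre_digraph.sccs_verts G"

definition vertex_cover :: "'a pair_pre_digraph \<Rightarrow> 'a set \<Rightarrow> bool" where
  "vertex_cover G C \<longleftrightarrow> C \<subseteq> pverts G \<and> (\<forall>(u, v) \<in> parcs G. u \<in> C \<or> v \<in> C)"

definition vc_number :: "'a pair_pre_digraph \<Rightarrow> nat" where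
  "vc_number G = Min (card ` {C. vertex_cover G C})"

definition minimum_vertex_cover :: "'a pair_pre_digraph \<Rightarrow> 'a set \<Rightarrow> bool" where
  "minimum_vertex_cover G C \<longleftrightarrow> vertex_cover G C \<and> card C = vc_number G"

text \<open>
  For a disconnected graph, only the components that contain an edge are counted on the right-hand
  side: isolated vertices are ignored, as they play no role for vertex covers. Counting them too
  would force a cover to contain vertices meeting no edge, and deleting edges (keeping their
  endpoints) would then drive the price of connectivity up without limit. For graphs without
  isolated vertices the two counts agree.
\<close>

definition connected_vertex_cover :: "'a pair_pre_digraph \<Rightarrow> 'a set \<Rightarrow> bool" where
  "connected_vertex_cover G C \<longleftrightarrow> vertex_cover G C \<and>
     (if connected (with_proj G) then connected (with_proj G \<restriction> C)
      else card (graph_components (with_proj G \<restriction> C))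
             = card {K \<in> graph_components (with_proj G). \<exists>(u, v) \<in> parcs G. u \<in> K \<and> v \<in> K})"

definition connected_vc_number :: "'a pair_pre_digraph \<Rightarrow> nat" where
  "connected_vc_number G = Min (card ` {C. connected_vertex_cover G C})"

definition price_of_connectivity :: "'a pair_pre_digraph \<Rightarrow> real" where
  "price_of_connectivity G = real (connected_vc_number G) / real (vc_number G)"

text \<open>The price is meaningful only for graphs with at least one edge, hence the two guards.\<close>

definition strongly_critical :: "'a pair_pre_digraph \<Rightarrow> bool" where
  "strongly_critical G \<longleftrightarrow> parcs G \<noteq> {} \<and>
     (\<forall>H. pair_graph H \<and> subgraph (with_proj H) (with_proj G) \<and> H \<noteq> G \<and> parcs H \<noteq> {}
        \<longrightarrow> price_of_connectivity H < price_of_connectivity G)"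

definition independent_set :: "'a pair_pre_digraph \<Rightarrow> 'a set \<Rightarrow> bool" where
  "independent_set G S \<longleftrightarrow> S \<subseteq> pverts G \<and> (\<forall>u \<in> S. \<forall>v \<in> S. (u, v) \<notin> parcs G)"

definition bipartite :: "'a pair_pre_digraph \<Rightarrow> bool" where
  "bipartite G \<longleftrightarrow>
     (\<exists>A B. A \<union> B = pverts G \<and> A \<inter> B = {} \<and> independent_set G A \<and> independent_set G B)"

definition cutvertex :: "'a pair_pre_digraph \<Rightarrow> 'a \<Rightarrow> bool" where
  "cutvertex G v \<longleftrightarrow> v \<in> pverts G \<and>
     card (graph_components (pre_digraph.del_vert (with_proj G) v)) > card (graph_components (with_proj G))"

text \<open>
  The library's \<^const>\<open>tree\<close> does not fit symmetric digraphs, where the two arcs of an edge form a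
  directed cycle of length 2. The cycles of a simple graph are the directed cycles of length at
  least 3.
\<close>

definition graph_tree :: "'a pair_pre_digraph \<Rightarrow> bool" where
  "graph_tree T \<longleftrightarrow> pair_graph T \<and> connected (with_proj T) \<and>
     \<not> (\<exists>p. pre_digraph.cycle (with_proj T) p \<and> length p \<ge> 3)"

text \<open>The vertex subdividing the edge \<open>{u, v}\<close> is \<open>Inr {u, v}\<close>.\<close>

definition subdivide_edges :: "'a pair_pre_digraph \<Rightarrow> ('a + 'a set) pair_pre_digraph" where
  "subdivide_edges T =
     \<lparr> pverts = Inl ` pverts T \<union> (\<lambda>(u, v). Inr {u, v}) ` parcs T,
       parcs = (\<Union>(u, v) \<in> parcs T. {(Inl u, Inr {u, v}), (Inr {u, v}, Inl u)}) \<rparr>"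

definition leaves :: "'a pair_pre_digraph \<Rightarrow> 'a set" where
  "leaves T = {v \<in> pverts T. out_degree (with_proj T) v = 1}"

text \<open>The pendant vertex attached to the leaf \<open>v\<close> is \<open>Inr v\<close>.\<close>

definition attach_pendants :: "'a pair_pre_digraph \<Rightarrow> ('a + 'a) pair_pre_digraph" where
  "attach_pendants T =
     \<lparr> pverts = Inl ` pverts T \<union> Inr ` leaves T,
       parcs = (\<lambda>(u, v). (Inl u, Inl v)) ` parcs T
         \<union> (\<Union>v \<in> leaves T. {(Inl v, Inr v), (Inr v, Inl v)}) \<rparr>"

text \<open>
  Taking the initial tree on the vertex type of \<open>G\<close> is no restriction, since a special tree has
  at least as many vertices as the tree it is obtained from.
\<close>

definition special_tree :: "'a pair_pre_digraph \<Rightarrow> bool" where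
  "special_tree G \<longleftrightarrow> (\<exists>T :: 'a pair_pre_digraph. graph_tree T \<and>
     digraph_iso (with_proj G) (with_proj (attach_pendants (subdivide_edges T))))"

end

(* Part (i). Suppose adjacent x, y lie in a minimum cover C.  If xy is a bridge, each side together
   with the pendant edge xy is a proper subgraph, and cheap connected covers of the two sides glue
   along xy.  Otherwise criticality of G - xy yields a connected cover of G - xy avoiding x and y, so
   G - x - y has just one component with edges.  As C loses two vertices there, that component has a
   connected cover D such that D + x + y is smaller than a minimum connected cover of G.  So it is not
   connected, and D has no neighbour of x or y.  A path then leads from x or y through some w to D,
   and either it extends to a path on five vertices in G, whose price 3/2 bounds that of G from below
   and leaves room for adding w, or x, y, w form a triangle and w can replace x or y.

   Part (ii). Every connected cover of G - e contains a cutvertex v of G, so deleting a non-bridge e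
   at v cannot lower the price.  Hence all edges at v are bridges, their other ends are leaves or
   again cutvertices, and G is a tree.  The connected cover number of a tree is the number of its
   inner vertices.  Take a minimum cover C of inner vertices, independent by (i).  Deleting a leaf at
   a vertex of C of degree at least three, or splitting a vertex outside C of degree at least three
   along an edge, again gives a subgraph whose price is not smaller, and what is left is the
   structure of a special tree. *)
theory Submission
  imports Defs
begin

section \<open>Connected covers and bridges\<close>

text \<open>Graphs are handled as symmetric relations, so that subgraphs are plain subsets. This is
  connectedness of the induced subgraph on S. Demanding S nonempty agrees with
  \<open>connected\<close>.\<close>

definition conn :: "('a \<times> 'a) set \<Rightarrow> 'a set \<Rightarrow> bool" where
  "conn E S \<longleftrightarrow> S \<noteq> {} \<and> (\<forall>u\<in>S. \<forall>v\<in>S. (u, v) \<in> (E \<inter> S \<times> S)\<^sup>*)"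

definition covers :: "('a \<times> 'a) set \<Rightarrow> 'a set \<Rightarrow> bool" where
  "covers E C \<longleftrightarrow> (\<forall>(u, v) \<in> E. u \<in> C \<or> v \<in> C)"

definition del_edge :: "('a \<times> 'a) set \<Rightarrow> 'a \<Rightarrow> 'a \<Rightarrow> ('a \<times> 'a) set" where
  "del_edge E u v = E - {(u, v), (v, u)}"

text \<open>Only the absence of a detour is recorded, so the property passes to subrelations, as in
  \<open>bridge_mono\<close>.\<close>

definition is_bridge :: "('a \<times> 'a) set \<Rightarrow> 'a \<Rightarrow> 'a \<Rightarrow> bool" where
  "is_bridge E u v \<longleftrightarrow> (u, v) \<notin> (del_edge E u v)\<^sup>*"

lemma coversI: "(\<And>u v. (u, v) \<in> E \<Longrightarrow> u \<notin> C \<Longrightarrow> v \<in> C) \<Longrightarrow> covers E C"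
  by (auto simp: covers_def)

lemma connD: "conn E S \<Longrightarrow> u \<in> S \<Longrightarrow> v \<in> S \<Longrightarrow> (u, v) \<in> (E \<inter> S \<times> S)\<^sup>*"
  by (auto simp: conn_def)

lemma conn_rtrancl: "conn E S \<Longrightarrow> u \<in> S \<Longrightarrow> v \<in> S \<Longrightarrow> (u, v) \<in> E\<^sup>*"
  by (meson Int_lower1 connD rtrancl_mono subsetD)

lemma conn_mono:
  assumes "conn E S" "E \<inter> S \<times> S \<subseteq> F"
  shows "conn F S"
proof -
  have "(E \<inter> S \<times> S)\<^sup>* \<subseteq> (F \<inter> S \<times> S)\<^sup>*"
    using assms(2) by (intro rtrancl_mono) auto
  then show ?thesis using assms(1) unfolding conn_def by blast
qed

lemma conn_within:
  assumes "E \<subseteq> S \<times> S"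
  shows "conn E S \<longleftrightarrow> S \<noteq> {} \<and> (\<forall>u\<in>S. \<forall>v\<in>S. (u, v) \<in> E\<^sup>*)"
proof -
  have "E \<inter> S \<times> S = E" using assms by auto
  then show ?thesis by (simp add: conn_def)
qed

lemma conn_singleton: "conn E {u}"
  by (auto simp: conn_def)

lemma conn_Un:
  assumes "conn E S" "conn E T" "S \<inter> T \<noteq> {}"
  shows "conn E (S \<union> T)"
proof -
  obtain w where w: "w \<in> S" "w \<in> T" using assms(3) by auto
  let ?R = "(E \<inter> (S \<union> T) \<times> (S \<union> T))\<^sup>*"
  have S: "(E \<inter> S \<times> S)\<^sup>* \<subseteq> ?R" and T: "(E \<inter> T \<times> T)\<^sup>* \<subseteq> ?R"
    by (intro rtrancl_mono; auto)+
  have 1: "(u, w) \<in> ?R" "(w, u) \<in> ?R" if "u \<in> S \<union> T" for u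
    using that connD[OF assms(1), of u w] connD[OF assms(1), of w u]
      connD[OF assms(2), of u w] connD[OF assms(2), of w u] S T w by auto
  have "(u, v) \<in> ?R" if "u \<in> S \<union> T" "v \<in> S \<union> T" for u v
    using 1(1)[OF that(1)] 1(2)[OF that(2)] by (rule rtrancl_trans)
  then show ?thesis using w unfolding conn_def by blast
qed

lemma conn_edge:
  assumes "sym E" "(u, v) \<in> E"
  shows "conn E {u, v}"
proof -
  have "(v, u) \<in> E" using assms by (meson symD)
  then show ?thesis using assms unfolding conn_def by (auto intro!: r_into_rtrancl)
qed

lemma conn_insert:
  assumes "sym E" "conn E S" "s \<in> S" "(s, u) \<in> E"
  shows "conn E (insert u S)"
proof -
  have "conn E (S \<union> {s, u})"
    using assms by (intro conn_Un conn_edge) auto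
  moreover have "S \<union> {s, u} = insert u S" using assms by auto
  ultimately show ?thesis by simp
qed

lemma conn_extend:
  assumes "sym E" "conn E S" "S \<subseteq> W" "\<And>w. w \<in> W \<Longrightarrow> w \<in> S \<or> (\<exists>s\<in>S. (s, w) \<in> E)"
  shows "conn E W"
proof -
  let ?R = "(E \<inter> W \<times> W)\<^sup>*"
  have 1: "\<exists>s\<in>S. (s, w) \<in> ?R \<and> (w, s) \<in> ?R" if w: "w \<in> W" for w
  proof (cases "w \<in> S")
    case False
    then obtain s where s: "s \<in> S" "(s, w) \<in> E" using assms(4) w by blast
    then have "(w, s) \<in> E" using assms(1) by (meson symD)
    then have "(s, w) \<in> ?R" "(w, s) \<in> ?R" using s w assms(3) by blast+
    then show ?thesis using s(1) by blast
  qed auto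
  have 2: "(s, t) \<in> ?R" if "s \<in> S" "t \<in> S" for s t
    using connD[OF assms(2) that] rtrancl_mono[of "E \<inter> S \<times> S" "E \<inter> W \<times> W"] assms(3) by blast
  have "(u, v) \<in> ?R" if uv: "u \<in> W" "v \<in> W" for u v
  proof -
    obtain s t where "s \<in> S" "(u, s) \<in> ?R" "t \<in> S" "(t, v) \<in> ?R"
      using 1[OF uv(1)] 1[OF uv(2)] by blast
    then show ?thesis using 2[of s t] by (meson rtrancl_trans)
  qed
  moreover have "W \<noteq> {}" using assms(2,3) by (auto simp: conn_def)
  ultimately show ?thesis by (simp add: conn_def)
qed

lemma conn_reachable_set:
  assumes "sym E"
  shows "conn E {v. (x, v) \<in> E\<^sup>*}"
proof -
  let ?K = "{v. (x, v) \<in> E\<^sup>*}"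
  have 1: "(x, v) \<in> (E \<inter> ?K \<times> ?K)\<^sup>*" if "(x, v) \<in> E\<^sup>*" for v
    using that
  proof induction
    case (step y z)
    then have "(y, z) \<in> E \<inter> ?K \<times> ?K" by (auto intro: rtrancl_into_rtrancl)
    with step show ?case by (meson rtrancl.rtrancl_into_rtrancl)
  qed auto
  have "sym (E \<inter> ?K \<times> ?K)" using assms by (auto simp: sym_def)
  then have "(v, x) \<in> (E \<inter> ?K \<times> ?K)\<^sup>*" if "(x, v) \<in> E\<^sup>*" for v
    using 1[OF that] by (meson sym_rtrancl symD)
  then show ?thesis unfolding conn_def using 1 by (auto intro: rtrancl_trans)
qed

text \<open>The crossing edge of a walk that leaves S. Most arguments below that use connectedness
  pick a suitable S and inspect this edge.\<close>

lemma rtrancl_exit: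
  assumes "(a, b) \<in> R\<^sup>*" "a \<in> S" "b \<notin> S"
  obtains u v where "u \<in> S" "v \<notin> S" "(u, v) \<in> R"
proof -
  have "b \<in> S \<or> (\<exists>u v. u \<in> S \<and> v \<notin> S \<and> (u, v) \<in> R)"
    using assms(1) by (induction) (use assms(2) in auto)
  then show ?thesis using that assms(3) by blast
qed

section \<open>Deleting an edge, bridges, and the two sides of a bridge\<close>

lemma del_edge_commute: "del_edge E u v = del_edge E v u"
  by (auto simp: del_edge_def)

lemma sym_del_edge: "sym E \<Longrightarrow> sym (del_edge E u v)"
  by (auto simp: del_edge_def sym_def)

lemma is_bridge_commute: "sym E \<Longrightarrow> is_bridge E u v \<longleftrightarrow> is_bridge E v u"
  unfolding is_bridge_def by (metis del_edge_commute symD sym_del_edge sym_rtrancl)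

text \<open>Each step along the deleted edge is replaced by the detour that exists because uv is no
  bridge.\<close>

lemma not_bridge_rtrancl:
  assumes "sym E" "\<not> is_bridge E u v" "(a, b) \<in> E\<^sup>*"
  shows "(a, b) \<in> (del_edge E u v)\<^sup>*"
  using assms(3)
proof induction
  case (step y z)
  have "(u, v) \<in> (del_edge E u v)\<^sup>*" "(v, u) \<in> (del_edge E u v)\<^sup>*"
    using assms(1,2) unfolding is_bridge_def by (auto dest: symD[OF sym_rtrancl[OF sym_del_edge]])
  then have "(y, z) \<in> (del_edge E u v)\<^sup>*"
    using step.hyps(2) by (auto simp: del_edge_def)
  then show ?case using step.IH by (meson rtrancl_trans)
qed auto

lemma not_bridge_conn:
  assumes "sym E" "E \<subseteq> V \<times> V" "conn E V" "\<not> is_bridge E u v"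
  shows "conn (del_edge E u v) V"
proof -
  have "del_edge E u v \<subseteq> V \<times> V" using assms(2) by (auto simp: del_edge_def)
  then show ?thesis
    using assms not_bridge_rtrancl[OF assms(1,4)] by (auto simp: conn_within)
qed

lemma bridge_mono:
  assumes "is_bridge E u v" "F \<subseteq> E"
  shows "is_bridge F u v"
  using assms rtrancl_mono[of "del_edge F u v" "del_edge E u v"]
  unfolding is_bridge_def del_edge_def by blast

text \<open>For a bridge xy of a connected graph, \<open>side E x y\<close> and
  \<open>side E y x\<close> are the two components left after deleting it.\<close>

definition side :: "('a \<times> 'a) set \<Rightarrow> 'a \<Rightarrow> 'a \<Rightarrow> 'a set" where
  "side E x y = {v. (x, v) \<in> (del_edge E x y)\<^sup>*}"

lemma side_self: "x \<in> side E x y"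
  by (simp add: side_def)

lemma side_step:
  assumes "u \<in> side E x y" "(u, v) \<in> E" "(u, v) \<noteq> (x, y)" "(u, v) \<noteq> (y, x)"
  shows "v \<in> side E x y"
  using assms unfolding side_def del_edge_def by (auto intro: rtrancl_into_rtrancl)

lemma side_disjoint:
  assumes "sym E" "is_bridge E x y"
  shows "side E x y \<inter> side E y x = {}"
proof (rule ccontr)
  assume "\<not> ?thesis"
  then obtain v where "(x, v) \<in> (del_edge E x y)\<^sup>*" "(y, v) \<in> (del_edge E x y)\<^sup>*"
    by (auto simp: side_def del_edge_commute[of E y x])
  then have "(x, y) \<in> (del_edge E x y)\<^sup>*"
    by (meson assms(1) rtrancl_trans symD sym_del_edge sym_rtrancl)
  then show False using assms(2) by (simp add: is_bridge_def)
qed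

lemma side_union:
  assumes "sym E" "E \<subseteq> V \<times> V" "conn E V" "(x, y) \<in> E"
  shows "side E x y \<union> side E y x = V"
proof
  have "v \<in> V" if "(x, v) \<in> E\<^sup>*" "x \<in> V" for x v
    using that assms(2) by (induction) auto
  moreover have "(del_edge E a b)\<^sup>* \<subseteq> E\<^sup>*" for a b by (rule rtrancl_mono) (auto simp: del_edge_def)
  moreover have "x \<in> V" "y \<in> V" using assms(2,4) by auto
  ultimately show "side E x y \<union> side E y x \<subseteq> V" using assms(2,4) unfolding side_def by blast
next
  show "V \<subseteq> side E x y \<union> side E y x"
  proof
    fix v assume "v \<in> V"
    then have "(x, v) \<in> E\<^sup>*" using assms by (auto intro: conn_rtrancl)
    then show "v \<in> side E x y \<union> side E y x"
    proof induction
      case (step u w)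
      have "x \<in> side E x y" "y \<in> side E y x" by (auto simp: side_self)
      then show ?case using step side_step[of u E x y w] side_step[of u E y x w] by blast
    qed (simp add: side_self)
  qed
qed

lemma conn_side:
  assumes "sym E"
  shows "conn E (side E x y)"
  unfolding side_def
  by (rule conn_mono[OF conn_reachable_set[OF sym_del_edge[OF assms]]]) (auto simp: del_edge_def)

text \<open>This is the source of lower bounds for connected covers. If u were missing, D would
  contain both s and t to cover su and ut, and a walk inside D from s to t would have to leave S,
  which is possible only through u.\<close>

lemma separator_in_conn_cover:
  assumes "covers E D" "conn E D" "(s, u) \<in> E" "(u, t) \<in> E" "s \<in> S" "t \<notin> S" "u \<notin> S"
    and "\<And>p q. (p, q) \<in> E \<Longrightarrow> p \<in> S \<Longrightarrow> q \<notin> S \<Longrightarrow> q = u"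
  shows "u \<in> D"
proof (rule ccontr)
  assume n: "u \<notin> D"
  then have "s \<in> D" "t \<in> D" using assms(1,3,4) by (auto simp: covers_def)
  then have "(s, t) \<in> (E \<inter> D \<times> D)\<^sup>*" using assms(2) by (intro connD)
  then obtain p q where "p \<in> S" "q \<notin> S" "(p, q) \<in> E \<inter> D \<times> D"
    using assms(5,6) by (rule rtrancl_exit)
  then show False using assms(8) n by blast
qed

text \<open>Here the bridge makes u the only exit from the side of s, while t lies on the side of
  u.\<close>

lemma two_nbrs_in_conn_cover:
  assumes "sym E" "is_bridge E u s" "(u, s) \<in> E" "(u, t) \<in> E" "s \<noteq> t"
    and "covers E D" "conn E D"
  shows "u \<in> D"
proof (rule separator_in_conn_cover[of E D s u t "side E s u"])
  have dis: "side E u s \<inter> side E s u = {}" using assms side_disjoint by metis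
  then show "u \<notin> side E s u" using side_self[of u E s] by auto
  have "(s, u) \<in> E" using assms by (meson symD)
  then show "(s, u) \<in> E" .
  have "t \<in> side E u s"
    using assms side_self[of u E s] dis side_self[of s E u] by (intro side_step[of u E u s t]) auto
  then show "t \<notin> side E s u" using dis by auto
  show "q = u" if "(p, q) \<in> E" "p \<in> side E s u" "q \<notin> side E s u" for p q
    using side_step[of p E s u q] that side_self[of s E u] by auto
qed (use assms side_self in auto)

text \<open>A walk enters a vertex outside I only to return to where it came from, so such visits
  can be cut out.\<close>

lemma conn_remove_leaves:
  assumes "sym E" "E \<subseteq> V \<times> V" "conn E V" "I \<subseteq> V" "I \<noteq> {}" "covers E I"
    and "\<And>w p q. w \<in> V - I \<Longrightarrow> (w, p) \<in> E \<Longrightarrow> (w, q) \<in> E \<Longrightarrow> p = q"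
  shows "conn E I"
proof -
  \<comment> \<open>At a vertex outside I the invariant speaks of its neighbours instead. Such a
    vertex has at most one, so nothing is lost while the walk makes its turn.\<close>
  have "(w \<in> I \<longrightarrow> (u, w) \<in> (E \<inter> I \<times> I)\<^sup>*) \<and> (w \<notin> I \<longrightarrow> (\<forall>p. (w, p) \<in> E \<longrightarrow> (u, p) \<in> (E \<inter> I \<times> I)\<^sup>*))"
    if u: "u \<in> I" and "(u, w) \<in> E\<^sup>*" for u w
    using that(2)
  proof induction
    case base then show ?case using u by simp
  next
    case (step y z)
    have zy: "(z, y) \<in> E" using step.hyps(2) assms(1) by (meson symD)
    show ?case
    proof (cases "y \<in> I")
      case True
      then have uy: "(u, y) \<in> (E \<inter> I \<times> I)\<^sup>*" using step by auto
      show ?thesis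
      proof (cases "z \<in> I")
        case True
        then have "(y, z) \<in> E \<inter> I \<times> I" using step \<open>y \<in> I\<close> by auto
        then show ?thesis using True uy by (meson rtrancl.rtrancl_into_rtrancl)
      next
        case False
        then have "p = y" if "(z, p) \<in> E" for p
          using assms(2,7) zy that by blast
        then show ?thesis using False uy by auto
      qed
    next
      case False
      moreover then have "z \<in> I" using step assms(6) by (auto simp: covers_def)
      ultimately show ?thesis using step by auto
    qed
  qed
  then show ?thesis using assms(3-5) unfolding conn_def
    by (metis assms(3) conn_rtrancl subset_iff)
qed

section \<open>Critical graphs\<close>

text \<open>The assumption \<open>crit\<close> is strong criticality for connected subgraphs with
  the denominators cleared. It may be stated for any cover C of the subgraph, since a larger C only
  weakens the inequality.\<close>

locale critical_graph =
  fixes V :: "'a set" and E :: "('a \<times> 'a) set" and \<tau> \<kappa> :: nat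
  assumes finite_V: "finite V" and E_sub: "E \<subseteq> V \<times> V" and sym_E: "sym E"
    and irrefl: "(u, u) \<notin> E" and conn_E: "conn E V" and E_ne: "E \<noteq> {}"
    and tau_le: "C \<subseteq> V \<Longrightarrow> covers E C \<Longrightarrow> \<tau> \<le> card C"
    and tau_ex: "\<exists>C\<subseteq>V. covers E C \<and> card C = \<tau>"
    and kappa_le: "D \<subseteq> V \<Longrightarrow> covers E D \<Longrightarrow> conn E D \<Longrightarrow> \<kappa> \<le> card D"
    and kappa_ex: "\<exists>D\<subseteq>V. covers E D \<and> conn E D \<and> card D = \<kappa>"
    and crit: "\<lbrakk>V' \<subseteq> V; E' \<subseteq> E; E' \<subseteq> V' \<times> V'; sym E'; conn E' V'; E' \<noteq> {}; E' \<noteq> E; C \<subseteq> V'; covers E' C\<rbrakk>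
      \<Longrightarrow> \<exists>D\<subseteq>V'. covers E' D \<and> conn E' D \<and> card D * \<tau> < \<kappa> * card C"
begin

lemma symE: "(u, v) \<in> E \<Longrightarrow> (v, u) \<in> E"
  using sym_E by (meson symD)

lemma fin: "S \<subseteq> V \<Longrightarrow> finite S"
  using finite_V finite_subset by blast

text \<open>A single edge is a proper subgraph of price 1, so the price of G exceeds 1.\<close>

lemma kappa_gt_tau:
  assumes "(x, y) \<in> E" "E \<noteq> {(x, y), (y, x)}"
  shows "\<tau> < \<kappa>"
proof -
  have xy: "conn {(x, y), (y, x)} {x, y}" by (rule conn_edge) (auto simp: sym_def)
  obtain D where D: "D \<subseteq> {x, y}" "covers {(x, y), (y, x)} D" "card D * \<tau> < \<kappa> * card {x}"
    using crit[of "{x, y}" "{(x, y), (y, x)}" "{x}"] assms symE E_sub xy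
    by (auto simp: covers_def sym_def)
  have "D \<noteq> {}" using D by (auto simp: covers_def)
  then have "1 \<le> card D" using D(1) by (metis One_nat_def Suc_leI card_gt_0_iff finite.emptyI finite.insertI finite_subset)
  then have "1 * \<tau> \<le> card D * \<tau>" by (rule mult_le_mono1)
  also have "\<dots> < \<kappa>" using D(3) by simp
  finally show ?thesis by simp
qed

text \<open>The path on five vertices has price 3/2: b and d cover it, and every connected cover
  contains b, c and d.\<close>

lemma P5_price:
  assumes "distinct [a, b, c, d, e]" "(a, b) \<in> E" "(b, c) \<in> E" "(c, d) \<in> E" "(d, e) \<in> E"
  shows "3 * \<tau> \<le> 2 * \<kappa>"
proof -
  let ?V = "{a, b, c, d, e}"
  let ?E = "{(a, b), (b, a), (b, c), (c, b), (c, d), (d, c), (d, e), (e, d)}"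
  have s: "sym ?E" by (auto simp: sym_def)
  have "conn ?E {a}" by (rule conn_singleton)
  then have "conn ?E {b, a}" by (rule conn_insert[OF s, of _ a]) auto
  then have "conn ?E {c, b, a}" by (rule conn_insert[OF s, of _ b]) auto
  then have "conn ?E {d, c, b, a}" by (rule conn_insert[OF s, of _ c]) auto
  then have "conn ?E {e, d, c, b, a}" by (rule conn_insert[OF s, of _ d]) auto
  moreover have "{e, d, c, b, a} = ?V" by auto
  ultimately have cV: "conn ?E ?V" by simp
  have cov: "covers ?E {b, d}" by (auto simp: covers_def)
  have big: "3 \<le> card D" if D: "D \<subseteq> ?V" "covers ?E D" "conn ?E D" for D
  proof -
    have finD: "finite D" using D(1) finite_subset by blast
    have ne: "a \<noteq> b" "a \<noteq> c" "a \<noteq> d" "a \<noteq> e" "b \<noteq> c" "b \<noteq> d" "b \<noteq> e" "c \<noteq> d" "c \<noteq> e" "d \<noteq> e"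
      using assms(1) by auto
    have "b \<in> D"
      by (rule separator_in_conn_cover[OF D(2,3), of a b c "{a}"]) (use ne in auto)
    moreover have "c \<in> D"
      by (rule separator_in_conn_cover[OF D(2,3), of b c d "{a, b}"]) (use ne in auto)
    moreover have "d \<in> D"
      by (rule separator_in_conn_cover[OF D(2,3), of c d e "{a, b, c}"]) (use ne in auto)
    ultimately have "{b, c, d} \<subseteq> D" by auto
    then have "card {b, c, d} \<le> card D" using finD by (rule card_mono[rotated])
    moreover have "card {b, c, d} = 3" using assms(1) by auto
    ultimately show ?thesis by simp
  qed
  have VV: "?V \<subseteq> V" "?E \<subseteq> E" using assms E_sub symE by auto
  have c2: "card {b, d} = 2" using assms(1) by auto
  show ?thesis
  proof (cases "E = ?E")
    case True
    have "?V = V"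
    proof (rule ccontr)
      assume "?V \<noteq> V"
      then obtain v where "v \<in> V" "v \<notin> ?V" using VV by auto
      then have "(a, v) \<in> E\<^sup>*" "a \<in> ?V" "v \<notin> ?V" using VV conn_E by (auto intro: conn_rtrancl)
      then obtain p q where "p \<in> ?V" "q \<notin> ?V" "(p, q) \<in> E" by (rule rtrancl_exit)
      then show False using True by auto
    qed
    then obtain D where "D \<subseteq> ?V" "covers ?E D" "conn ?E D" "card D = \<kappa>"
      using kappa_ex True by metis
    then have "3 \<le> \<kappa>" using big by metis
    moreover have "\<tau> \<le> 2" using tau_le[of "{b, d}"] cov True VV c2 by auto
    ultimately show ?thesis by auto
  next
    case False
    obtain D where D: "D \<subseteq> ?V" "covers ?E D" "conn ?E D" "card D * \<tau> < \<kappa> * card {b, d}"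
      using crit[OF VV(1,2) _ s cV _ _ _ cov] False by auto
    have "3 * \<tau> \<le> card D * \<tau>" using big D by (intro mult_le_mono1) auto
    also have "\<dots> < \<kappa> * 2" using D(4) c2 by simp
    finally show ?thesis by simp
  qed
qed

section \<open>Minimum covers are independent\<close>

lemma kappa_le_insert2:
  assumes "D \<subseteq> V" "x \<in> V" "y \<in> V" "covers E (insert x (insert y D))" "conn E (insert x (insert y D))"
  shows "\<kappa> \<le> card D + 2"
proof -
  have "\<kappa> \<le> card (insert x (insert y D))" using assms by (intro kappa_le) auto
  also have "\<dots> \<le> card D + 2" by (simp add: card_insert_le_m1 card_insert_if assms(1) fin)
  finally show ?thesis .
qed

text \<open>By minimality x cannot be dropped from C, so some edge at x is covered by x
  alone.\<close>

lemma outside_neighbour: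
  assumes C: "C \<subseteq> V" "covers E C" "card C = \<tau>" and "x \<in> C"
  obtains z where "(x, z) \<in> E" "z \<notin> C"
proof -
  have "card (C - {x}) < \<tau>" using assms fin[OF C(1)] by (metis card_Diff1_less)
  then have "\<not> covers E (C - {x})" using tau_le[of "C - {x}"] C by auto
  then obtain u v where "(u, v) \<in> E" "u \<notin> C - {x}" "v \<notin> C - {x}" by (auto simp: covers_def)
  moreover then have "u \<in> C \<or> v \<in> C" using C(2) by (auto simp: covers_def)
  moreover have "u \<noteq> v" using calculation(1) irrefl by auto
  ultimately show ?thesis using that[of v] that[of u] symE[of u v] by auto
qed

text \<open>The two sides partition C, so the strict inequalities add up to one against
  \<kappa>\<tau>. It is used to show that connected covers of two pieces are together too
  small.\<close>

lemma split_bridge_cards: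
  assumes "is_bridge E x y" "(x, y) \<in> E" "C \<subseteq> V" "card C = \<tau>"
    and D1: "d1 * \<tau> < \<kappa> * card (C \<inter> side E x y)" and D2: "d2 * \<tau> < \<kappa> * card (C \<inter> side E y x)"
  shows "d1 + d2 < \<kappa>"
proof -
  have "C = (C \<inter> side E x y) \<union> (C \<inter> side E y x)"
    using side_union[OF sym_E E_sub conn_E assms(2)] assms(3) by blast
  moreover have "card ((C \<inter> side E x y) \<union> (C \<inter> side E y x)) = card (C \<inter> side E x y) + card (C \<inter> side E y x)"
    using side_disjoint[OF sym_E assms(1)] fin[OF assms(3)] by (intro card_Un_disjoint) auto
  ultimately have "card C = card (C \<inter> side E x y) + card (C \<inter> side E y x)" by simp
  then have "(d1 + d2) * \<tau> < \<kappa> * \<tau>" using D1 D2 assms(4) by (simp add: algebra_simps)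
  then show ?thesis by simp
qed

lemma bridge_not_in_min_cover:
  assumes C: "C \<subseteq> V" "covers E C" "card C = \<tau>"
    and xy: "(x, y) \<in> E" "x \<in> C" "y \<in> C" and br: "is_bridge E x y"
  shows False
proof -
  have half: "\<exists>D\<subseteq>V. x \<in> D \<and> conn E D \<and> covers (E \<inter> side E x y \<times> side E x y) D
      \<and> card D * \<tau> < \<kappa> * card (C \<inter> side E x y)"
    if xy: "(x, y) \<in> E" "x \<in> C" "y \<in> C" and br: "is_bridge E x y" for x y
  proof -
    obtain z where z: "(x, z) \<in> E" "z \<notin> C" using outside_neighbour[OF C xy(2)] .
    obtain z' where z': "(y, z') \<in> E" "z' \<notin> C" using outside_neighbour[OF C xy(3)] .
    let ?S = "side E x y"
    \<comment> \<open>The edge xy is kept as a pendant edge so that a connected cover of this piece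
      is forced to contain x. It adds nothing to the cover number, because x already lies in
      C.\<close>
    let ?E = "E \<inter> ?S \<times> ?S \<union> {(x, y), (y, x)}"
    have SV: "?S \<union> side E y x = V" using side_union[OF sym_E E_sub conn_E xy(1)] .
    have dis: "?S \<inter> side E y x = {}" using side_disjoint[OF sym_E br] .
    have xS: "x \<in> ?S" "y \<notin> ?S" using dis side_self by fast+
    have zS: "z \<in> ?S" using z xy xS by (intro side_step[of x E x y z]) auto
    have "z' \<in> side E y x" using z' xy xS side_self[of y E x]
      by (intro side_step[of y E y x z']) auto
    then have z'S: "z' \<notin> ?S" using dis by auto
    have sym: "sym ?E" using symE by (auto simp: sym_def)
    have "conn ?E ?S" by (rule conn_mono[OF conn_side[OF sym_E]]) auto
    then have "conn ?E (insert y ?S)" by (rule conn_insert[OF sym, of _ x]) (use xS in auto)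
    moreover have "covers ?E (C \<inter> ?S)" using C(2) xy xS by (auto simp: covers_def)
    \<comment> \<open>The piece is proper: the edge from y to its neighbour outside C lies beyond
      the bridge.\<close>
    moreover have "(y, z') \<notin> ?E" using z' xy xS by auto
    then have "?E \<noteq> E" using z'(1) by metis
    moreover have "insert y ?S \<subseteq> V" using SV xy E_sub by auto
    moreover have "?E \<subseteq> E" using xy symE by auto
    moreover have "?E \<subseteq> insert y ?S \<times> insert y ?S" using xS by auto
    ultimately obtain D where D: "D \<subseteq> insert y ?S" "covers ?E D" "conn ?E D" "card D * \<tau> < \<kappa> * card (C \<inter> ?S)"
      using crit[of "insert y ?S" ?E "C \<inter> ?S"] sym by auto
    \<comment> \<open>Without x, the cover D contains y and z. But x is the only neighbour of y in
      this piece, so y would be cut off from z.\<close>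
    have "x \<in> D"
    proof (rule ccontr)
      assume x: "x \<notin> D"
      then have "y \<in> D" "z \<in> D" using D(2) z zS xS by (auto simp: covers_def)
      then have "(y, z) \<in> (?E \<inter> D \<times> D)\<^sup>*" "y \<noteq> z" using D(3) xy z by (auto intro: connD)
      then obtain w where "(y, w) \<in> ?E \<inter> D \<times> D" by (meson converse_rtranclE)
      then show False using x xS xy irrefl by auto
    qed
    moreover have "conn E D" using D(3) \<open>?E \<subseteq> E\<close> by (meson conn_mono le_infI1)
    moreover have "D \<subseteq> V" using D(1) \<open>insert y ?S \<subseteq> V\<close> by auto
    ultimately show ?thesis using D by (auto simp: covers_def)
  qed
  obtain D1 where D1: "D1 \<subseteq> V" "x \<in> D1" "conn E D1" "covers (E \<inter> side E x y \<times> side E x y) D1"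
    "card D1 * \<tau> < \<kappa> * card (C \<inter> side E x y)"
    using half[OF xy br] by blast
  obtain D2 where D2: "D2 \<subseteq> V" "y \<in> D2" "conn E D2" "covers (E \<inter> side E y x \<times> side E y x) D2"
    "card D2 * \<tau> < \<kappa> * card (C \<inter> side E y x)"
    using half[of y x] xy br symE is_bridge_commute[OF sym_E] by blast
  have "conn E (insert y D1)" using conn_insert[OF sym_E D1(3,2) xy(1)] .
  then have "conn E (insert y D1 \<union> D2)" using D2 by (intro conn_Un) auto
  then have cn: "conn E (D1 \<union> D2)" using D2(2) by (simp add: insert_absorb)
  have "covers E (D1 \<union> D2)"
  proof (rule coversI)
    fix u v assume uv: "(u, v) \<in> E" "u \<notin> D1 \<union> D2"
    then have "u \<in> side E x y \<union> side E y x"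
      using side_union[OF sym_E E_sub conn_E xy(1)] E_sub by auto
    then show "v \<in> D1 \<union> D2"
      using uv D1(2,4) D2(2,4) side_step[of u E x y v] side_step[of u E y x v]
      by (auto simp: covers_def)
  qed
  then have "\<kappa> \<le> card (D1 \<union> D2)" using cn D1 D2 by (intro kappa_le) auto
  also have "\<dots> \<le> card D1 + card D2" by (rule card_Un_le)
  finally show False
    using split_bridge_cards[OF br xy(1) C(1,3) D1(5) D2(5)] by linarith
qed

text \<open>G - xy stays connected and C still covers it, hence \<kappa> drops. If D contained x or
  y, it would cover xy as well and be a connected cover of G with fewer than \<kappa>
  vertices.\<close>

lemma crit_del_nonbridge:
  assumes "(x, y) \<in> E" "\<not> is_bridge E x y" "E \<noteq> {(x, y), (y, x)}"
  shows "\<exists>D\<subseteq>V. covers (del_edge E x y) D \<and> conn (del_edge E x y) D \<and> card D < \<kappa> \<and> x \<notin> D \<and> y \<notin> D"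
proof -
  obtain C where C: "C \<subseteq> V" "covers E C" "card C = \<tau>" using tau_ex by blast
  let ?E = "del_edge E x y"
  have sub: "?E \<subseteq> E" by (auto simp: del_edge_def)
  have "(y, x) \<in> E" using assms symE by simp
  then have "?E \<noteq> {}" "?E \<noteq> E" using assms by (auto simp: del_edge_def)
  moreover have "conn ?E V" using assms E_sub sym_E conn_E by (intro not_bridge_conn) auto
  moreover have "covers ?E C" using C sub by (auto simp: covers_def)
  ultimately obtain D where D: "D \<subseteq> V" "covers ?E D" "conn ?E D" "card D * \<tau> < \<kappa> * card C"
    using crit[of V ?E C] E_sub sub C sym_del_edge[OF sym_E] by auto
  have lt: "card D < \<kappa>" using D(4) C(3) by simp
  have cn: "conn E D" using D(3) sub by (meson conn_mono le_infI1)
  have "covers E D" if "x \<in> D \<or> y \<in> D" using D(2) that by (auto simp: covers_def del_edge_def)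
  then have "x \<notin> D" "y \<notin> D" using kappa_le[OF D(1) _ cn] lt by auto
  then show ?thesis using D lt by blast
qed

lemma nonbridge_not_in_min_cover:
  assumes C: "C \<subseteq> V" "covers E C" "card C = \<tau>"
    and xy: "(x, y) \<in> E" "x \<in> C" "y \<in> C" and br: "\<not> is_bridge E x y"
  shows False
proof -
  have xy_ne: "x \<noteq> y" using xy irrefl by auto
  have xyV: "x \<in> V" "y \<in> V" using xy E_sub by auto
  obtain z where z: "(x, z) \<in> E" "z \<notin> C" using outside_neighbour[OF C xy(2)] .
  obtain z' where z': "(y, z') \<in> E" "z' \<notin> C" using outside_neighbour[OF C xy(3)] .
  have "E \<noteq> {(x, y), (y, x)}" using z xy by auto
  note kt = kappa_gt_tau[OF xy(1) this]
  obtain D' where D': "D' \<subseteq> V" "covers (del_edge E x y) D'" "conn (del_edge E x y) D'"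
    "card D' < \<kappa>" "x \<notin> D'" "y \<notin> D'"
    using crit_del_nonbridge[OF xy(1) br] z xy by blast
  let ?E = "E \<inter> (- {x, y}) \<times> (- {x, y})"
  \<comment> \<open>This drops the isolated vertices of G - x - y outside D'. The rest is connected,
    since D' is connected and meets every edge.\<close>
  let ?V = "D' \<union> Field ?E"
  have sym': "sym ?E" using symE by (auto simp: sym_def)
  have subV: "?V \<subseteq> V" using D'(1) E_sub by (auto simp: Field_def)
  have notV: "x \<notin> ?V" "y \<notin> ?V" using D' by (auto simp: Field_def)
  have cD': "conn ?E D'" by (rule conn_mono[OF D'(3)]) (use D' in \<open>auto simp: del_edge_def\<close>)
  have cov: "covers ?E D'" using D'(2) by (auto simp: covers_def del_edge_def)
  have "conn ?E ?V"
  proof (rule conn_extend[OF sym' cD'])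
    fix w assume "w \<in> ?V"
    then consider "w \<in> D'" | v where "(v, w) \<in> ?E" using symE by (fastforce simp: Field_def)
    then show "w \<in> D' \<or> (\<exists>s\<in>D'. (s, w) \<in> ?E)" using cov by cases (auto simp: covers_def)
  qed auto
  \<comment> \<open>Otherwise {x, y} would be a connected cover no larger than C, against \<tau> <
    \<kappa>.\<close>
  moreover have ne: "?E \<noteq> {}"
  proof
    assume "?E = {}"
    then have "covers E {x, y}" unfolding covers_def by blast
    moreover have "conn E {x, y}" using xy(1) sym_E by (intro conn_edge)
    ultimately have "\<kappa> \<le> card {x, y}" using xyV by (intro kappa_le) auto
    also have "\<dots> \<le> card C" using xy fin[OF C(1)] by (intro card_mono) auto
    finally show False using C kt by simp
  qed
  moreover have "covers ?E (C \<inter> ?V)" using C(2) by (auto simp: covers_def Field_def)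
  moreover have "?E \<noteq> E" using xy by auto
  ultimately obtain D where D: "D \<subseteq> ?V" "covers ?E D" "conn ?E D" "card D * \<tau> < \<kappa> * card (C \<inter> ?V)"
    using crit[of ?V ?E "C \<inter> ?V"] subV sym' by (auto simp: Field_def)
  have DV: "D \<subseteq> V" and xD: "x \<notin> D" "y \<notin> D" using D(1) subV notV by auto
  have cD: "conn E D" using D(3) by (rule conn_mono) auto
  have Dne: "D \<noteq> {}" using D(3) by (simp add: conn_def)
  have "card (C \<inter> ?V) \<le> card (C - {x, y})" using notV fin[OF C(1)] by (intro card_mono) auto
  also have "\<dots> = \<tau> - 2" using xy xy_ne C(3) fin[OF C(1)] by (simp add: card_Diff_subset)
  finally have "\<kappa> * card (C \<inter> ?V) \<le> \<kappa> * (\<tau> - 2)" by (rule mult_le_mono2)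
  moreover have "2 \<le> \<tau>" using card_mono[of C "{x, y}"] fin[OF C(1)] xy xy_ne C(3) by auto
  \<comment> \<open>The cover C loses both x and y, which produces the term 2\<kappa>. It can be
    traded for 2\<tau> at once, and for 3\<tau> when a path on five vertices is present.\<close>
  ultimately have size: "card D * \<tau> + 2 * \<kappa> < \<kappa> * \<tau>"
    using D(4) mult_le_mono2[of 2 \<tau> \<kappa>] by (simp add: diff_mult_distrib2 algebra_simps)
  then have "(card D + 2) * \<tau> < \<kappa> * \<tau>" using kt by (simp add: algebra_simps)
  then have small: "card D + 2 < \<kappa>" unfolding mult_less_cancel2 by blast
  have covxy: "covers E (insert x (insert y D))" using D(2) by (auto simp: covers_def)
  \<comment> \<open>An edge from x or y to D would make D + x + y a connected cover with fewer than
    \<kappa> vertices.\<close>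
  have touch: "(p, d) \<notin> E" if "p \<in> {x, y}" "d \<in> D" for p d
  proof
    assume pd: "(p, d) \<in> E"
    have "conn E (insert p D)" using conn_insert[OF sym_E cD that(2)] pd symE by blast
    then have "conn E (insert x (insert y D))"
      using that(1) conn_insert[OF sym_E, of "insert x D" x y] conn_insert[OF sym_E, of "insert y D" y x]
        xy(1) symE by (auto simp: insert_commute)
    then show False using kappa_le_insert2[OF DV xyV covxy] small by simp
  qed
  obtain p w d where p: "p \<in> {x, y}" "(p, w) \<in> E" "w \<notin> {x, y}" and wd: "(w, d) \<in> E" "d \<in> D"
  proof -
    \<comment> \<open>A walk towards D leaves the closed neighbourhood of {x, y} along an edge wd
      that avoids x and y, so D meets it. As w is adjacent to x or y, it is not in D, and hence d
      is.\<close>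
    let ?S = "{x, y} \<union> {w. (x, w) \<in> E \<or> (y, w) \<in> E}"
    obtain d0 where d0: "d0 \<in> D" using Dne by auto
    have "(x, d0) \<in> E\<^sup>*" using conn_E d0 DV xyV by (auto intro: conn_rtrancl)
    moreover have "x \<in> ?S" by simp
    moreover have "d0 \<notin> ?S" using d0 touch xD by auto
    ultimately obtain w d where wd: "w \<in> ?S" "d \<notin> ?S" "(w, d) \<in> E"
      by (rule rtrancl_exit)
    then have "w \<notin> {x, y}" by auto
    moreover have "d \<notin> {x, y}" using wd by auto
    ultimately have "w \<in> D \<or> d \<in> D" using D(2) wd(3) by (auto simp: covers_def)
    then have "d \<in> D" using wd(1) touch \<open>w \<notin> {x, y}\<close> by auto
    then show thesis using that[of x w d] that[of y w d] wd \<open>w \<notin> {x, y}\<close> by auto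
  qed
  obtain q where q: "{p, q} = {x, y}" "p \<noteq> q" using p(1) xy_ne by auto
  have pq: "(p, q) \<in> E" using q xy(1) symE by (auto simp: doubleton_eq_iff)
  have wV: "w \<in> V" "p \<in> V" "q \<in> V" using wd E_sub pq by auto
  have ins: "insert x (insert y D) = insert p (insert q D)" using q(1) by auto
  \<comment> \<open>Otherwise d, w, r, s, v is a path on five vertices. By \<open>P5_price\<close>
    the gap then grows to |D| + 3 < \<kappa>, which leaves room for adding w: D + w + x + y is a
    connected cover.\<close>
  have only: "v = w" if v: "(s, v) \<in> E" "v \<noteq> r" and rs: "{r, s} = {x, y}" "r \<noteq> s" "(r, w) \<in> E" for r s v
  proof (rule ccontr)
    assume vw: "v \<noteq> w"
    have r: "(r, s) \<in> E" using rs xy(1) symE by (auto simp: doubleton_eq_iff)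
    have "r \<in> {x, y}" "s \<in> {x, y}" using rs by auto
    then have "distinct [d, w, r, s, v]"
      using vw v rs(2) p(3) wd touch xD irrefl r by auto
    then have "3 * \<tau> \<le> 2 * \<kappa>" using P5_price[of d w r s v] wd(1) rs(3) r v(1) symE by blast
    then have "(card D + 3) * \<tau> < \<kappa> * \<tau>" using size by (simp add: algebra_simps)
    then have lt: "card D + 3 < \<kappa>" unfolding mult_less_cancel2 by blast
    have "conn E (insert w D)" using conn_insert[OF sym_E cD wd(2)] wd(1) symE by blast
    then have "conn E (insert p (insert w D))"
      using conn_insert[OF sym_E _ _ symE[OF p(2)]] by blast
    then have "conn E (insert q (insert p (insert w D)))"
      using conn_insert[OF sym_E _ _ pq] by blast
    moreover have "insert q (insert p (insert w D)) = insert x (insert y (insert w D))"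
      using q(1) by auto
    moreover have "covers E (insert x (insert y (insert w D)))"
      using covxy by (auto simp: covers_def)
    ultimately have "\<kappa> \<le> card (insert w D) + 2"
      using DV wV xyV by (intro kappa_le_insert2) auto
    also have "\<dots> \<le> card D + 3" by (simp add: card_insert_if fin[OF DV])
    finally show False using lt by simp
  qed
  \<comment> \<open>The neighbour of q outside C differs from p, so by the previous claim it is w,
    and p, q, w form a triangle.\<close>
  have "\<exists>v. (q, v) \<in> E \<and> v \<noteq> p"
    using q z z' xy by (auto simp: doubleton_eq_iff)
  then have qw: "(q, w) \<in> E" using only[OF _ _ q p(2)] by blast
  \<comment> \<open>All neighbours of q are p or w, so w can take the place of q. As w also connects
    p to D, this cover is connected and has at most |D| + 2 vertices.\<close>
  have "covers E (insert p (insert w D))"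
  proof (rule coversI)
    fix u v assume uv: "(u, v) \<in> E" "u \<notin> insert p (insert w D)"
    have "u = q \<or> v \<in> insert p (insert q D)" using uv covxy ins by (auto simp: covers_def)
    then show "v \<in> insert p (insert w D)"
      using only[OF _ _ q p(2), of u] only[OF _ _ q p(2), of v] uv symE[OF uv(1)] by auto
  qed
  moreover have "conn E (insert p (insert w D))"
    using conn_insert[OF sym_E cD wd(2), of w] wd(1) conn_insert[OF sym_E, of "insert w D" w p] p(2) symE
    by blast
  ultimately have "\<kappa> \<le> card D + 2" using kappa_le_insert2[OF DV wV(2,1)] by simp
  then show False using small by simp
qed

theorem min_cover_independent:
  assumes "C \<subseteq> V" "covers E C" "card C = \<tau>" "(x, y) \<in> E" "x \<in> C"
  shows "y \<notin> C"
  using assms bridge_not_in_min_cover nonbridge_not_in_min_cover by blast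

section \<open>Cutvertices force all edges to be bridges\<close>

definition separates :: "'a \<Rightarrow> bool" where
  "separates v \<longleftrightarrow> v \<in> V \<and>
     (\<exists>a\<in>V - {v}. \<exists>b\<in>V - {v}. (a, b) \<notin> (E \<inter> (V - {v}) \<times> (V - {v}))\<^sup>*)"

text \<open>Provides the data for \<open>separator_in_conn_cover\<close>, so that v lies in every
  connected cover of F. It is stated for connected spanning subgraphs because it is applied to G and
  to G minus a nonbridge.\<close>

lemma separates_nbrs:
  assumes "separates v" "sym F" "F \<subseteq> E" "conn F V"
  shows "\<exists>S s t. (s, v) \<in> F \<and> (v, t) \<in> F \<and> s \<in> S \<and> t \<notin> S \<and> v \<notin> S \<and>
    (\<forall>p q. (p, q) \<in> F \<longrightarrow> p \<in> S \<longrightarrow> q \<notin> S \<longrightarrow> q = v)"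
proof -
  let ?W = "V - {v}"
  let ?R = "E \<inter> ?W \<times> ?W"
  obtain a b where ab: "a \<in> ?W" "b \<in> ?W" "(a, b) \<notin> ?R\<^sup>*" and v: "v \<in> V"
    using assms(1) by (auto simp: separates_def)
  \<comment> \<open>The components of G - v are taken in E, not in F. An edge of F that leaves one
    of them can still only go to v.\<close>
  define K where "K = (\<lambda>a. {u. (a, u) \<in> ?R\<^sup>*})"
  have KW: "u \<in> ?W" if "x \<in> ?W" "u \<in> K x" for x u
    using that(2) unfolding K_def mem_Collect_eq by (induction) (use that(1) in auto)
  have exit: "q = v" if "x \<in> ?W" "(p, q) \<in> F" "p \<in> K x" "q \<notin> K x" for x p q
  proof (rule ccontr)
    assume "q \<noteq> v"
    then have "(p, q) \<in> ?R" using that KW[of x p] assms(3) E_sub by auto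
    then show False using that(3,4) unfolding K_def by (auto intro: rtrancl_into_rtrancl)
  qed
  have nbr: "\<exists>s\<in>K x. (s, v) \<in> F" if x: "x \<in> ?W" for x
  proof -
    have "(x, v) \<in> F\<^sup>*" using assms(4) x v by (auto intro: conn_rtrancl)
    moreover have "x \<in> K x" by (simp add: K_def)
    moreover have "v \<notin> K x" using KW[OF x] by auto
    ultimately obtain p q where "p \<in> K x" "q \<notin> K x" "(p, q) \<in> F" by (rule rtrancl_exit)
    then show ?thesis using exit[OF x] by blast
  qed
  obtain s t where st: "s \<in> K a" "(s, v) \<in> F" "t \<in> K b" "(t, v) \<in> F"
    using nbr ab by blast
  have "sym ?R" using symE by (auto simp: sym_def)
  then have "(t, b) \<in> ?R\<^sup>*" using st(3) unfolding K_def by (auto dest: symD[OF sym_rtrancl])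
  then have "t \<notin> K a" using ab(3) unfolding K_def by (auto dest: rtrancl_trans)
  moreover have "v \<notin> K a" using KW[OF ab(1)] by auto
  moreover have "(v, t) \<in> F" using st(4) assms(2) by (meson symD)
  ultimately show ?thesis using st exit[OF ab(1)] by (intro exI[of _ "K a"] exI[of _ s] exI[of _ t]) blast
qed

text \<open>For a nonbridge vw, criticality gives a connected cover of G - vw that avoids v. But G -
  vw is connected and v separates it too, so v belongs to all its connected covers.\<close>

lemma separates_edge_bridge:
  assumes "separates v" "(v, w) \<in> E"
  shows "is_bridge E v w"
proof (rule ccontr)
  assume nb: "\<not> is_bridge E v w"
  have "E \<noteq> {(v, w), (w, v)}"
  proof
    assume E: "E = {(v, w), (w, v)}"
    obtain S s t where "(s, v) \<in> E" "(v, t) \<in> E" "s \<in> S" "t \<notin> S"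
      using separates_nbrs[OF assms(1) sym_E subset_refl conn_E] by blast
    then show False using E irrefl by auto
  qed
  then obtain D where D: "covers (del_edge E v w) D" "conn (del_edge E v w) D" "v \<notin> D"
    using crit_del_nonbridge[OF assms(2) nb] by blast
  have "conn (del_edge E v w) V" using not_bridge_conn[OF sym_E E_sub conn_E nb] .
  moreover have "del_edge E v w \<subseteq> E" by (auto simp: del_edge_def)
  ultimately obtain S s t where st: "(s, v) \<in> del_edge E v w" "(v, t) \<in> del_edge E v w" "s \<in> S" "t \<notin> S" "v \<notin> S"
    and S: "\<forall>p q. (p, q) \<in> del_edge E v w \<longrightarrow> p \<in> S \<longrightarrow> q \<notin> S \<longrightarrow> q = v"
    using separates_nbrs[OF assms(1) sym_del_edge[OF sym_E]] by blast
  have "v \<in> D" by (rule separator_in_conn_cover[OF D(1,2) st]) (use S in blast)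
  then show False using D(3) by simp
qed

text \<open>A walk from z to v avoiding w would, together with the edge wz, be a detour around the
  bridge vw.\<close>

lemma bridge_end_separates:
  assumes "is_bridge E v w" "(v, w) \<in> E" "(w, z) \<in> E" "z \<noteq> v"
  shows "separates w"
proof -
  let ?R = "E \<inter> (V - {w}) \<times> (V - {w})"
  have "(z, v) \<notin> ?R\<^sup>*"
  proof
    assume "(z, v) \<in> ?R\<^sup>*"
    moreover have "?R \<subseteq> del_edge E w v" by (auto simp: del_edge_def)
    ultimately have "(z, v) \<in> (del_edge E w v)\<^sup>*" by (meson rtrancl_mono subsetD)
    moreover have "(w, z) \<in> del_edge E w v" using assms by (auto simp: del_edge_def)
    ultimately have "(w, v) \<in> (del_edge E w v)\<^sup>*" by (meson converse_rtrancl_into_rtrancl)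
    then show False using assms(1) is_bridge_commute[OF sym_E] by (auto simp: is_bridge_def)
  qed
  moreover have "z \<in> V - {w}" "v \<in> V - {w}" "w \<in> V" using assms E_sub irrefl by auto
  ultimately show ?thesis unfolding separates_def by blast
qed

text \<open>The property spreads along walks from v: the far end of a bridge is a leaf or separates,
  and in the latter case all its edges are bridges as well.\<close>

lemma all_bridges:
  assumes "separates v" "(x, y) \<in> E"
  shows "is_bridge E x y"
proof -
  have "(v, x) \<in> E\<^sup>*" using assms conn_E E_sub by (auto simp: separates_def intro: conn_rtrancl)
  then have "\<forall>y. (x, y) \<in> E \<longrightarrow> is_bridge E x y"
  proof induction
    case base
    then show ?case using separates_edge_bridge[OF assms(1)] by blast
  next
    case (step x z)
    show ?case
    proof (intro allI impI)
      fix y assume zy: "(z, y) \<in> E"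
      have br: "is_bridge E x z" using step by blast
      show "is_bridge E z y"
      proof (cases "y = x")
        case True
        then show ?thesis using br is_bridge_commute[OF sym_E] by blast
      next
        case False
        then show ?thesis using separates_edge_bridge bridge_end_separates[OF br step(2) zy] zy by blast
      qed
    qed
  qed
  then show ?thesis using assms(2) by blast
qed

section \<open>Inner vertices and critical trees\<close>

definition inner :: "'a set" where
  "inner = {u. \<exists>s t. s \<noteq> t \<and> (u, s) \<in> E \<and> (u, t) \<in> E}"

lemma inner_sub: "inner \<subseteq> V"
  using E_sub by (auto simp: inner_def)

lemma separates_inner:
  assumes "separates v"
  shows "v \<in> inner"
proof -
  obtain S s t where "(s, v) \<in> E" "(v, t) \<in> E" "s \<in> S" "t \<notin> S"
    using separates_nbrs[OF assms sym_E subset_refl conn_E] by blast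
  then have "s \<noteq> t" "(v, s) \<in> E" "(v, t) \<in> E" using symE by auto
  then show ?thesis by (auto simp: inner_def)
qed

end

text \<open>A connected graph whose edges are all bridges is a tree. A nonempty \<open>inner\<close>
  excludes the single edge.\<close>

locale critical_tree = critical_graph +
  assumes bridges: "(x, y) \<in> E \<Longrightarrow> is_bridge E x y"
    and inner_ne: "inner \<noteq> {}"
begin

text \<open>The ends of an uncovered edge would have only each other as neighbours and form a
  component without inner vertices.\<close>

lemma covers_inner: "covers E inner"
proof (rule coversI, rule ccontr)
  fix u w assume uw: "(u, w) \<in> E" "u \<notin> inner" "w \<notin> inner"
  obtain v where v: "v \<in> inner" using inner_ne by auto
  have "(u, v) \<in> E\<^sup>*" using uw v E_sub inner_sub conn_E by (auto intro: conn_rtrancl)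
  moreover have "u \<in> {u, w}" "v \<notin> {u, w}" using uw v by auto
  ultimately obtain p q where "p \<in> {u, w}" "q \<notin> {u, w}" "(p, q) \<in> E" by (rule rtrancl_exit)
  then show False using uw symE[OF uw(1)] unfolding inner_def by blast
qed

lemma conn_inner: "conn E inner"
  by (rule conn_remove_leaves[OF sym_E E_sub conn_E inner_sub inner_ne covers_inner])
    (auto simp: inner_def)

lemma kappa_le_inner: "\<kappa> \<le> card inner"
  using kappa_le inner_sub covers_inner conn_inner by blast

text \<open>Bridges of the tree remain bridges in F. So a subgraph in which all inner vertices keep
  two neighbours has no connected cover smaller than \<open>inner\<close>.\<close>

lemma in_conn_cover:
  assumes "F \<subseteq> E" "sym F" "covers F D" "conn F D" "(u, s) \<in> F" "(u, t) \<in> F" "s \<noteq> t"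
  shows "u \<in> D"
proof (rule two_nbrs_in_conn_cover[OF assms(2) _ assms(5,6,7,3,4)])
  show "is_bridge F u s" using bridge_mono[OF bridges assms(1)] assms(1,5) by blast
qed

text \<open>A leaf in a minimum cover can be replaced by its neighbour, which covers the same
  edge.\<close>

lemma inner_min_cover:
  obtains C where "C \<subseteq> inner" "covers E C" "card C = \<tau>"
proof -
  obtain C where C: "C \<subseteq> V" "covers E C" "card C = \<tau>" using tau_ex by blast
  \<comment> \<open>The last branch is a default for vertices without neighbours, chosen to keep the
    image inside \<open>inner\<close>.\<close>
  define f where "f c = (if c \<in> inner then c else if \<exists>s. (c, s) \<in> E then SOME s. (c, s) \<in> E else SOME v. v \<in> inner)" for c
  have leaf: "f c = s" if "c \<notin> inner" "(c, s) \<in> E" for c s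
  proof -
    have "t = s" if "(c, t) \<in> E" for t using \<open>c \<notin> inner\<close> \<open>(c, s) \<in> E\<close> that by (auto simp: inner_def)
    then have "(SOME s. (c, s) \<in> E) = s" using that(2) by blast
    then show ?thesis using that by (auto simp: f_def)
  qed
  have fC: "f c \<in> inner" for c
  proof -
    consider "c \<in> inner" | s where "c \<notin> inner" "(c, s) \<in> E" | "c \<notin> inner" "\<nexists>s. (c, s) \<in> E" by blast
    then show ?thesis
    proof cases
      case 2
      then show ?thesis using leaf covers_inner by (auto simp: covers_def)
    next
      case 3
      then show ?thesis using inner_ne by (auto simp: f_def some_in_eq)
    qed (simp add: f_def)
  qed
  have fcov: "v \<in> f ` C" if "u \<in> C" "u \<notin> f ` C" "(u, v) \<in> E" for u v
  proof -
    have "u \<notin> inner" using that(1,2) unfolding f_def by force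
    then show ?thesis using leaf that by force
  qed
  have cov: "covers E (f ` C)"
  proof (rule coversI)
    fix u v assume uv: "(u, v) \<in> E" "u \<notin> f ` C"
    show "v \<in> f ` C"
    proof (cases "u \<in> C")
      case True then show ?thesis using fcov uv by blast
    next
      case False
      then have "v \<in> C" using C(2) uv by (auto simp: covers_def)
      then show ?thesis using fcov symE uv by blast
    qed
  qed
  have "card (f ` C) \<le> \<tau>" using C fin by (metis card_image_le)
  moreover have "f ` C \<subseteq> inner" using fC by auto
  ultimately show thesis using that[of "f ` C"] tau_le cov inner_sub by (meson le_antisym order_trans)
qed

text \<open>Delete the leaf p. Only c loses a neighbour, and with two others left every inner vertex
  still has degree at least two. Connected covers thus have at least |inner| vertices, while C
  remains a cover, so the price has not dropped.\<close>

lemma pendant_nbr_degree: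
  assumes C: "C \<subseteq> inner" "covers E C" "card C = \<tau>"
    and p: "(c, p) \<in> E" "p \<notin> inner" and st: "(c, s) \<in> E" "(c, t) \<in> E" "s \<noteq> p" "t \<noteq> p"
  shows "s = t"
proof (rule ccontr)
  assume ne: "s \<noteq> t"
  let ?V = "V - {p}"
  let ?E = "E \<inter> ?V \<times> ?V"
  have only: "u = c" if "(p, u) \<in> E" for u
    using p that symE[OF p(1)] by (auto simp: inner_def)
  have "c \<in> V" using p E_sub by auto
  have "conn E ?V"
  proof (rule conn_remove_leaves[OF sym_E E_sub conn_E])
    show "?V \<noteq> {}" using \<open>c \<in> V\<close> p irrefl by auto
    show "covers E ?V" using E_sub irrefl by (auto simp: covers_def)
    show "\<And>w p' q. w \<in> V - ?V \<Longrightarrow> (w, p') \<in> E \<Longrightarrow> (w, q) \<in> E \<Longrightarrow> p' = q" using only by blast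
  qed auto
  then have "conn ?E ?V" by (rule conn_mono) auto
  moreover have sym': "sym ?E" using symE by (auto simp: sym_def)
  moreover have sE: "(c, s) \<in> ?E" "(c, t) \<in> ?E" using st p E_sub irrefl by auto
  moreover have "?E \<noteq> E" using p by auto
  moreover have "C \<subseteq> ?V" using C(1) p(2) inner_sub by auto
  moreover have "covers ?E C" using C(2) by (auto simp: covers_def)
  ultimately obtain D where D: "D \<subseteq> ?V" "covers ?E D" "conn ?E D" "card D * \<tau> < \<kappa> * card C"
    using crit[of ?V ?E C] by auto
  have "u \<in> D" if u_inner: "u \<in> inner" for u
  proof -
    obtain s' t' where "s' \<noteq> t'" "(u, s') \<in> ?E" "(u, t') \<in> ?E"
    proof (cases "u = c")
      case False
      obtain s' t' where u: "s' \<noteq> t'" "(u, s') \<in> E" "(u, t') \<in> E" using u_inner by (auto simp: inner_def)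
      moreover have "s' \<noteq> p" "t' \<noteq> p" using False only u symE by auto
      moreover have "u \<noteq> p" using u_inner p by auto
      ultimately show thesis using that[of s' t'] E_sub by auto
    qed (use that ne sE in blast)
    then show ?thesis using in_conn_cover[OF _ sym' D(2,3)] by blast
  qed
  moreover have "finite D" using D(1) by (intro fin) auto
  ultimately have "card inner \<le> card D" by (intro card_mono) auto
  moreover have "card D < \<kappa>" using D(4) C(3) by simp
  ultimately show False using kappa_le_inner by simp
qed

text \<open>With three neighbours at b, split the tree along bc. Every inner vertex keeps two
  neighbours in one of the pieces, b itself through c1 and c2, so the connected covers of the pieces
  together contain \<open>inner\<close>, contradicting \<open>split_bridge_cards\<close>.\<close>

lemma connector_degree:
  assumes C: "C \<subseteq> V" "covers E C" "card C = \<tau>"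
    and b: "b \<notin> C" "(b, c) \<in> E" "(b, c1) \<in> E" "(b, c2) \<in> E" "c1 \<noteq> c" "c2 \<noteq> c"
  shows "c1 = c2"
proof (rule ccontr)
  assume ne: "c1 \<noteq> c2"
  let ?S = "side E b c" and ?T = "side E c b"
  have br: "is_bridge E b c" using bridges b by blast
  have un: "?S \<union> ?T = V" using side_union[OF sym_E E_sub conn_E b(2)] .
  have dis: "?S \<inter> ?T = {}" using side_disjoint[OF sym_E br] .
  have bS: "b \<in> ?S" "b \<notin> ?T" and cT: "c \<in> ?T" "c \<notin> ?S" using dis side_self by fast+
  have bc: "b \<noteq> c" using b irrefl by auto
  have cS: "c1 \<in> ?S" "c2 \<in> ?S"
    using b bc bS by (auto intro: side_step[of b E b c])
  have cC: "c \<in> C" using C(2) b by (auto simp: covers_def)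
  let ?E1 = "E \<inter> ?S \<times> ?S"
  \<comment> \<open>The edge bc goes to the piece of c, so that c loses no neighbour there. It is
    covered by c, and C splits without overlap.\<close>
  let ?E2 = "E \<inter> ?T \<times> ?T \<union> {(b, c), (c, b)}"
  have s1: "sym ?E1" and s2: "sym ?E2" using symE by (auto simp: sym_def)
  have "conn ?E1 ?S" by (rule conn_mono[OF conn_side[OF sym_E]]) auto
  moreover have "?E1 \<noteq> E" using b cT by auto
  moreover have "(b, c1) \<in> ?E1" using b bS cS by auto
  then have "?E1 \<noteq> {}" by blast
  moreover have "covers ?E1 (C \<inter> ?S)" using C(2) by (auto simp: covers_def)
  ultimately obtain D1 where D1: "D1 \<subseteq> ?S" "covers ?E1 D1" "conn ?E1 D1" "card D1 * \<tau> < \<kappa> * card (C \<inter> ?S)"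
    using crit[of ?S ?E1 "C \<inter> ?S"] s1 un by auto
  have "conn ?E2 ?T" by (rule conn_mono[OF conn_side[OF sym_E]]) auto
  then have "conn ?E2 (insert b ?T)" by (rule conn_insert[OF s2, of _ c]) (use cT in auto)
  moreover have "(b, c1) \<notin> ?E2" using b bS by auto
  then have "?E2 \<noteq> E" using b(3) by metis
  moreover have E2: "?E2 \<subseteq> E" using b symE by auto
  moreover have "?E2 \<subseteq> insert b ?T \<times> insert b ?T" using cT by auto
  moreover have "covers ?E2 (C \<inter> ?T)" using C(2) cC cT by (auto simp: covers_def)
  moreover have "insert b ?T \<subseteq> V" using un bS by auto
  ultimately obtain D2 where D2: "D2 \<subseteq> insert b ?T" "covers ?E2 D2" "conn ?E2 D2" "card D2 * \<tau> < \<kappa> * card (C \<inter> ?T)"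
    using crit[of "insert b ?T" ?E2 "C \<inter> ?T"] s2 by auto
  have "inner \<subseteq> D1 \<union> D2"
  proof
    fix u assume "u \<in> inner"
    then obtain s t where u: "s \<noteq> t" "(u, s) \<in> E" "(u, t) \<in> E" by (auto simp: inner_def)
    then have "u \<in> V" using E_sub by auto
    then consider "u = b" | "u \<in> ?S" "u \<noteq> b" | "u \<in> ?T" using un by auto
    then show "u \<in> D1 \<union> D2"
    proof cases
      case 1
      then have "(u, c1) \<in> ?E1" "(u, c2) \<in> ?E1" using b bS cS by auto
      then show ?thesis using in_conn_cover[OF _ s1 D1(2,3)] ne by blast
    next
      case 2
      then have "s \<in> ?S" "t \<in> ?S" using u cT by (auto intro: side_step[of u E b c])
      then have "(u, s) \<in> ?E1" "(u, t) \<in> ?E1" using u 2 by auto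
      then show ?thesis using in_conn_cover[OF _ s1 D1(2,3)] u by blast
    next
      case 3
      have "(u, w) \<in> ?E2" if "(u, w) \<in> E" for w
        using side_step[of u E c b w] that 3 bS by auto
      then show ?thesis using in_conn_cover[OF E2 s2 D2(2,3)] u by blast
    qed
  qed
  moreover have "finite (D1 \<union> D2)" using D1(1) D2(1) un bS by (intro fin) auto
  ultimately have "card inner \<le> card (D1 \<union> D2)" by (rule card_mono[rotated])
  also have "\<dots> \<le> card D1 + card D2" by (rule card_Un_le)
  finally show False
    using split_bridge_cards[OF br b(2) C(1,3) D1(4) D2(4)] kappa_le_inner by linarith
qed

text \<open>If all neighbours of c were leaves, the tree would be a star with centre c and \<kappa>
  at most 1, against 0 < \<tau> < \<kappa>.\<close>

lemma cover_vertex_inner_nbr: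
  assumes C: "C \<subseteq> inner" "covers E C" "card C = \<tau>" and c: "c \<in> C"
  shows "\<exists>b\<in>inner. (c, b) \<in> E"
proof (rule ccontr)
  assume n: "\<not> ?thesis"
  have cV: "c \<in> V" using C(1) c inner_sub by auto
  have "covers E {c}"
  proof (rule coversI, rule ccontr)
    fix u v assume uv: "(u, v) \<in> E" "u \<notin> {c}" "v \<notin> {c}"
    let ?S = "insert c {w. (c, w) \<in> E}"
    have leaf: "y = c" if "(c, w) \<in> E" "(w, y) \<in> E" for w y
      using n that symE[OF that(1)] unfolding inner_def by blast
    have "u \<in> ?S"
    proof (rule ccontr)
      assume u: "u \<notin> ?S"
      have "(c, u) \<in> E\<^sup>*" using uv E_sub cV conn_E by (auto intro: conn_rtrancl)
      moreover have "c \<in> ?S" by simp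
      ultimately obtain p q where "p \<in> ?S" "q \<notin> ?S" "(p, q) \<in> E" using u by (rule rtrancl_exit)
      then show False using leaf by auto
    qed
    then show False using leaf uv by auto
  qed
  then have "\<kappa> \<le> 1" using kappa_le[of "{c}"] cV conn_singleton[of E c] by auto
  moreover obtain s t where "s \<noteq> t" "(c, s) \<in> E" "(c, t) \<in> E" using c C(1) by (auto simp: inner_def)
  then have "\<tau> < \<kappa>" using irrefl by (intro kappa_gt_tau[of c s]) auto
  moreover have "finite C" using C(1) inner_sub by (intro fin) auto
  then have "\<tau> \<noteq> 0" using C(3) c card_0_eq by blast
  ultimately show False by simp
qed

end

section \<open>Recognising special trees\<close>

lemma rtrancl_on_iff: "(u, v) \<in> rtrancl_on S R \<longleftrightarrow> u \<in> S \<and> (u, v) \<in> (R \<inter> S \<times> S)\<^sup>*"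
proof
  assume "(u, v) \<in> rtrancl_on S R"
  then show "u \<in> S \<and> (u, v) \<in> (R \<inter> S \<times> S)\<^sup>*"
  proof (induction rule: rtrancl_on_induct)
    case (step y z)
    then have "(y, z) \<in> R \<inter> S \<times> S" by auto
    then show ?case using step.IH by (meson rtrancl.rtrancl_into_rtrancl)
  qed auto
next
  assume "u \<in> S \<and> (u, v) \<in> (R \<inter> S \<times> S)\<^sup>*"
  then have "(u, v) \<in> (R \<inter> S \<times> S)\<^sup>*" "u \<in> S" by auto
  then show "(u, v) \<in> rtrancl_on S R"
    by induction (auto intro: rtrancl_on_into_rtrancl_on)
qed

lemma connected_iff_conn:
  fixes H :: "('a, 'a \<times> 'a) pre_digraph"
  assumes "tail H = fst" "head H = snd" "sym (arcs H)"
  shows "connected H \<longleftrightarrow> conn (arcs H) (verts H)"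
proof -
  have "parcs (mk_symmetric H) = arcs H"
    using assms by (auto simp: parcs_mk_symmetric sym_def)
  moreover have "pverts (mk_symmetric H) = verts H" by (simp add: mk_symmetric_def)
  ultimately show ?thesis
    by (auto simp: connected_def strongly_connected_def conn_def reachable_def rtrancl_on_iff)
qed

lemma connected_with_proj_iff:
  assumes "sym (parcs G)"
  shows "connected (with_proj G) \<longleftrightarrow> conn (parcs G) (pverts G)"
  using connected_iff_conn[of "with_proj G"] assms by simp

lemma connected_induce_iff:
  assumes "sym (parcs G)"
  shows "connected (with_proj G \<restriction> C) \<longleftrightarrow> conn (parcs G) C"
proof -
  have "arcs (with_proj G \<restriction> C) = parcs G \<inter> C \<times> C" by auto
  moreover have "sym (parcs G \<inter> C \<times> C)" using assms by (auto simp: sym_def)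
  ultimately have "connected (with_proj G \<restriction> C) \<longleftrightarrow> conn (parcs G \<inter> C \<times> C) C"
    using connected_iff_conn[of "with_proj G \<restriction> C"] by simp
  also have "\<dots> \<longleftrightarrow> conn (parcs G) C" by (auto simp: conn_def Int_assoc)
  finally show ?thesis .
qed

lemma pcas_rtrancl: "pcas u p v \<Longrightarrow> set p \<subseteq> R \<Longrightarrow> (u, v) \<in> R\<^sup>*"
  by (induction p arbitrary: u) (auto intro: converse_rtrancl_into_rtrancl)

lemma pawalk_verts_eq: "pcas u p v \<Longrightarrow> pawalk_verts u p = u # map snd p"
  by (induction p arbitrary: u) auto

lemma pcas_last: "pcas u p v \<Longrightarrow> p \<noteq> [] \<Longrightarrow> snd (last p) = v"
  by (induction p arbitrary: u) (auto split: if_splits)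

lemma pcas_append: "pcas u (p @ q) v \<longleftrightarrow> (\<exists>w. pcas u p w \<and> pcas w q v)"
  by (induction p arbitrary: u) auto

text \<open>After its first arc (u, v) the cycle is a walk from v back to u, and it is a detour as
  soon as it avoids both arcs of the edge uv.\<close>

lemma cycle_imp_not_bridge:
  assumes "pair_graph T" "pre_digraph.cycle (with_proj T) p" "length p \<ge> 3"
  obtains u v where "(u, v) \<in> parcs T" "\<not> is_bridge (parcs T) u v"
proof -
  interpret T: pair_graph T by fact
  obtain u where u: "T.awalk u p u" "distinct (tl (T.awalk_verts u p))"
    using assms(2) by (auto simp: T.cycle_def)
  have pc: "pcas u p u" and sub: "set p \<subseteq> parcs T"
    using u(1) by (auto simp: T.awalk_def)
  obtain e q where p: "p = e # q" using assms(3) by (cases p) auto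
  obtain v where e: "e = (u, v)" using pc p by (cases e) auto
  have q: "pcas v q u" using pc p e by simp
  have "distinct (map snd p)" using u(2) pawalk_verts_eq[OF pc] by (simp add: awalk_verts_with_proj_eq)
  then have dis: "v \<notin> snd ` set q" "distinct (map snd q)" using p e by auto
  \<comment> \<open>Since heads are distinct, the arc (v, u) could only be the last one. The walk
    before it is nonempty by \<open>length p \<ge> 3\<close> and returns to v, so v would occur
    twice as a head.\<close>
  have "(v, u) \<notin> set q"
  proof
    assume vu: "(v, u) \<in> set q"
    then have "q \<noteq> []" by auto
    have lq: "last q = (v, u)"
      using vu pcas_last[OF q \<open>q \<noteq> []\<close>] dis(2) \<open>q \<noteq> []\<close>
      by (auto simp: distinct_map dest!: inj_onD[of snd "set q" "(v, u)" "last q"])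
    have bq: "q = butlast q @ [(v, u)]" using append_butlast_last_id[OF \<open>q \<noteq> []\<close>] lq by simp
    then have "pcas v (butlast q @ [(v, u)]) u" using q by simp
    then have "pcas v (butlast q) v" by (auto simp: pcas_append)
    moreover have "butlast q \<noteq> []" using assms(3) p by (cases q rule: rev_cases) auto
    ultimately have "v = snd (last (butlast q))" "last (butlast q) \<in> set (butlast q)"
      using pcas_last by fastforce+
    then have "v \<in> snd ` set q" by (auto dest: in_set_butlastD)
    then show False using dis(1) by blast
  qed
  moreover have "(u, v) \<notin> set q" using dis(1) by force
  ultimately have "set q \<subseteq> del_edge (parcs T) v u" using sub p by (auto simp: del_edge_def)
  then have "(v, u) \<in> (del_edge (parcs T) v u)\<^sup>*" using pcas_rtrancl[OF q] by blast
  then have "\<not> is_bridge (parcs T) v u" by (simp add: is_bridge_def)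
  moreover have "(v, u) \<in> parcs T" using sub p e T.sym_arcs by (auto simp: symmetric_def dest: symD)
  ultimately show thesis using that by blast
qed

text \<open>The facts about G and C that determine the shape. C is the vertex set of the original
  tree, and the other vertices are subdivision vertices of degree two or pendant ones. A vertex of C
  next to a leaf has one further neighbour and is a leaf of the original tree;
  \<open>has_connector\<close> rules out stars.\<close>

locale subdivided_tree =
  fixes V :: "'a set" and E :: "('a \<times> 'a) set" and C :: "'a set"
  assumes finite_V: "finite V" and E_sub: "E \<subseteq> V \<times> V" and sym_E: "sym E"
    and conn_E: "conn E V" and E_ne: "E \<noteq> {}"
    and bridges: "(x, y) \<in> E \<Longrightarrow> is_bridge E x y"
    and C_sub: "C \<subseteq> V" and alternating: "(u, v) \<in> E \<Longrightarrow> u \<in> C \<longleftrightarrow> v \<notin> C"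
    and connector_degree: "b \<notin> C \<Longrightarrow> (b, c) \<in> E \<Longrightarrow> (b, c1) \<in> E \<Longrightarrow> (b, c2) \<in> E \<Longrightarrow> c1 \<noteq> c \<Longrightarrow> c2 \<noteq> c \<Longrightarrow> c1 = c2"
    and not_leaf: "c \<in> C \<Longrightarrow> \<exists>s t. s \<noteq> t \<and> (c, s) \<in> E \<and> (c, t) \<in> E"
    and pendant_nbr_degree: "c \<in> C \<Longrightarrow> (c, p) \<in> E \<Longrightarrow> (\<And>u. (p, u) \<in> E \<Longrightarrow> u = c) \<Longrightarrow>
      (c, s) \<in> E \<Longrightarrow> (c, t) \<in> E \<Longrightarrow> s \<noteq> p \<Longrightarrow> t \<noteq> p \<Longrightarrow> s = t"
    and has_connector: "c \<in> C \<Longrightarrow> \<exists>b c'. (c, b) \<in> E \<and> (b, c') \<in> E \<and> c' \<noteq> c"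
begin

lemma symE: "(u, v) \<in> E \<Longrightarrow> (v, u) \<in> E"
  using sym_E by (meson symD)

definition joined :: "('a \<times> 'a) set" where
  "joined = {(c, c'). c \<in> C \<and> c \<noteq> c' \<and> (\<exists>b. (c, b) \<in> E \<and> (b, c') \<in> E)}"

text \<open>The original tree of the special tree: vertices of C at distance two in G become
  adjacent.\<close>

definition skeleton :: "'a pair_pre_digraph" where
  "skeleton = \<lparr>pverts = C, parcs = joined\<rparr>"

definition pendant :: "'a \<Rightarrow> 'a \<Rightarrow> bool" where
  "pendant p c \<longleftrightarrow> (c, p) \<in> E \<and> c \<in> C \<and> (\<forall>u. (p, u) \<in> E \<longrightarrow> u = c)"

lemma joined_sub: "joined \<subseteq> C \<times> C"
  using alternating by (auto simp: joined_def)

lemma sym_joined: "sym joined"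
  using alternating symE unfolding joined_def sym_def by blast

text \<open>Two different connectors would close a 4-cycle, whose edges are not bridges.\<close>

lemma connector_unique:
  assumes "c \<noteq> c'" "(c, b) \<in> E" "(b, c') \<in> E" "(c, b') \<in> E" "(b', c') \<in> E"
  shows "b = b'"
proof (rule ccontr)
  assume ne: "b \<noteq> b'"
  have "c \<noteq> b" "b \<noteq> c'" using assms alternating by blast+
  then have "(c, b') \<in> del_edge E c b" "(b', c') \<in> del_edge E c b" "(c', b) \<in> del_edge E c b"
    using assms symE ne by (auto simp: del_edge_def)
  then have "(c, b) \<in> (del_edge E c b)\<^sup>*" by (meson r_into_rtrancl rtrancl.rtrancl_into_rtrancl)
  then show False using bridges[OF assms(2)] by (simp add: is_bridge_def)
qed

lemma connector_nbrs:
  assumes "b \<notin> C" "(b, c) \<in> E" "(b, c') \<in> E" "c \<noteq> c'"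
  shows "{w. (b, w) \<in> E} = {c, c'}"
  using connector_degree[OF assms(1,2,3)] assms by blast

lemma vertex_cases:
  assumes "v \<in> V"
  obtains "v \<in> C" | c c' where "v \<notin> C" "(v, c) \<in> E" "(v, c') \<in> E" "c \<noteq> c'" | c where "v \<notin> C" "pendant v c"
proof -
  obtain x y where xy: "(x, y) \<in> E" using E_ne by auto
  have "\<exists>w. (v, w) \<in> E"
  proof (cases "v = x")
    case False
    have "(v, x) \<in> E\<^sup>*" using assms xy E_sub conn_E by (auto intro: conn_rtrancl)
    then show ?thesis using False by (meson converse_rtranclE)
  qed (use xy in auto)
  then obtain w where w: "(v, w) \<in> E" by auto
  then show thesis using that alternating[OF w] symE[OF w] unfolding pendant_def by blast
qed

text \<open>The isomorphism onto the special tree. The outer \<open>Inl\<close> is the subdivided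
  tree, where a connector is named by its neighbourhood, the skeleton edge it subdivides. The outer
  \<open>Inr\<close> holds the pendants, each named by the leaf \<open>Inl c\<close> that carries
  it.\<close>

definition embed :: "'a \<Rightarrow> ('a + 'a set) + ('a + 'a set)" where
  "embed v = (if v \<in> C then Inl (Inl v)
     else if \<exists>c c'. c \<noteq> c' \<and> (v, c) \<in> E \<and> (v, c') \<in> E then Inl (Inr {w. (v, w) \<in> E})
     else Inr (Inl (THE c. (v, c) \<in> E)))"

lemma embed_cover: "v \<in> C \<Longrightarrow> embed v = Inl (Inl v)"
  by (simp add: embed_def)

lemma embed_connector:
  assumes "b \<notin> C" "(b, c) \<in> E" "(b, c') \<in> E" "c \<noteq> c'"
  shows "embed b = Inl (Inr {c, c'})"
  using connector_nbrs[OF assms] assms unfolding embed_def by auto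

lemma pendantD:
  assumes "pendant p c"
  shows "(c, p) \<in> E" "c \<in> C" "(p, c) \<in> E"
  using assms symE unfolding pendant_def by blast+

lemma pendant_only: "pendant p c \<Longrightarrow> (p, u) \<in> E \<Longrightarrow> u = c"
  unfolding pendant_def by blast

lemma pendant_notin: "pendant p c \<Longrightarrow> p \<notin> C"
  using alternating by (auto simp: pendant_def)

lemma embed_pendant:
  assumes "pendant p c"
  shows "embed p = Inr (Inl c)"
proof -
  have "(THE c. (p, c) \<in> E) = c"
    using pendantD(3)[OF assms] pendant_only[OF assms] by blast
  moreover have "\<nexists>c c'. c \<noteq> c' \<and> (p, c) \<in> E \<and> (p, c') \<in> E" using pendant_only[OF assms] by metis
  ultimately show ?thesis using pendant_notin[OF assms] by (simp add: embed_def)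
qed

text \<open>Besides p, the vertex c would have the two neighbours p' and a connector.\<close>

lemma pendant_unique:
  assumes "pendant p c" "pendant p' c"
  shows "p = p'"
proof (rule ccontr)
  assume ne: "p \<noteq> p'"
  obtain b c' where b: "(c, b) \<in> E" "(b, c') \<in> E" "c' \<noteq> c"
    using has_connector[OF pendantD(2)[OF assms(1)]] by blast
  then have "b \<noteq> p" "b \<noteq> p'" using assms pendant_only by blast+
  then show False
    using pendant_nbr_degree[OF pendantD(2,1)[OF assms(1)] pendant_only[OF assms(1)], of p' b]
      pendantD[OF assms(2)] b(1) ne assms(2) pendant_only b(2,3) by blast
qed

lemma embed_cases:
  assumes "v \<in> V"
  obtains "v \<in> C" "embed v = Inl (Inl v)"
    | c c' where "v \<notin> C" "(v, c) \<in> E" "(v, c') \<in> E" "c \<noteq> c'" "embed v = Inl (Inr {c, c'})"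
    | c where "pendant v c" "embed v = Inr (Inl c)"
  using assms
proof (cases rule: vertex_cases)
  case 1
  then show thesis using that(1) embed_cover by simp
next
  case (2 c c')
  then show thesis using that(2) embed_connector[OF 2] by simp
next
  case (3 c)
  then show thesis using that(3) embed_pendant by simp
qed

lemma inj_embed: "inj_on embed V"
proof (rule inj_onI)
  fix u v assume u: "u \<in> V" and v: "v \<in> V" and uv: "embed u = embed v"
  from u show "u = v"
  proof (cases rule: embed_cases)
    case 1
    from v show ?thesis by (cases rule: embed_cases) (use uv 1(2) in simp_all)
  next
    case (2 c c')
    note u2 = this
    from v show ?thesis
    proof (cases rule: embed_cases)
      case (2 d d')
      then have "{c, c'} = {d, d'}" using uv u2(5) by simp
      then have "(v, c) \<in> E" "(v, c') \<in> E" using 2 by (auto simp: doubleton_eq_iff)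
      then show ?thesis using connector_unique[of c c' u v] u2 symE by blast
    qed (use uv u2(5) in simp_all)
  next
    case (3 c)
    note u3 = this
    from v show ?thesis
    proof (cases rule: embed_cases)
      case (3 d)
      then have "c = d" using uv u3(2) by simp
      then show ?thesis using 3 u3(1) pendant_unique by simp
    qed (use uv u3(2) in simp_all)
  qed
qed

section \<open>Leaves, vertices and arcs of the special tree over the skeleton\<close>

abbreviation "subdivided \<equiv> subdivide_edges skeleton"

lemma subdivided_verts: "pverts subdivided = Inl ` C \<union> (\<lambda>(u, v). Inr {u, v}) ` joined"
  by (simp add: subdivide_edges_def skeleton_def)

lemma subdivided_arcs:
  "parcs subdivided = (\<Union>(u, v) \<in> joined. {(Inl u, Inr {u, v}), (Inr {u, v}, Inl u)})"
  by (simp add: subdivide_edges_def skeleton_def)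

lemma joinedI: "c \<in> C \<Longrightarrow> c \<noteq> c' \<Longrightarrow> (c, b) \<in> E \<Longrightarrow> (b, c') \<in> E \<Longrightarrow> (c, c') \<in> joined"
  by (auto simp: joined_def)

text \<open>Without a pendant, two neighbours of c are connectors and lead to different vertices of
  C by \<open>connector_unique\<close>. With one, c has a single connector, and that has a single
  other end.\<close>

lemma card_joined_eq_1:
  assumes c: "c \<in> C"
  shows "card {c'. (c, c') \<in> joined} = 1 \<longleftrightarrow> (\<exists>p. pendant p c)"
proof
  assume "card {c'. (c, c') \<in> joined} = 1"
  then obtain d where d: "{c'. (c, c') \<in> joined} = {d}" by (rule card_1_singletonE)
  obtain s t where st: "s \<noteq> t" "(c, s) \<in> E" "(c, t) \<in> E" using not_leaf c by blast
  show "\<exists>p. pendant p c"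
  proof (rule ccontr)
    assume "\<nexists>p. pendant p c"
    then have *: "\<exists>c'. (w, c') \<in> E \<and> c' \<noteq> c" if "(c, w) \<in> E" for w
      using that c by (auto simp: pendant_def)
    obtain c1 c2 where c12: "(s, c1) \<in> E" "c1 \<noteq> c" "(t, c2) \<in> E" "c2 \<noteq> c"
      using *[OF st(2)] *[OF st(3)] by blast
    have "(c, c1) \<in> joined" "(c, c2) \<in> joined"
      using joinedI[OF c _ st(2) c12(1)] joinedI[OF c _ st(3) c12(3)] c12 by simp_all
    then have "c1 = d" "c2 = d" using d by auto
    then show False using connector_unique[of c d s t] c12 st by blast
  qed
next
  assume "\<exists>p. pendant p c"
  then obtain p where p: "pendant p c" ..
  obtain b c' where b: "(c, b) \<in> E" "(b, c') \<in> E" "c' \<noteq> c" using has_connector c by blast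
  have "d = c'" if d: "(c, d) \<in> joined" for d
  proof -
    obtain b' where b': "(c, b') \<in> E" "(b', d) \<in> E" "c \<noteq> d" using d by (auto simp: joined_def)
    have "b \<noteq> p" "b' \<noteq> p" using b b' pendant_only[OF p] by blast+
    then have "b' = b" using pendant_nbr_degree[OF c pendantD(1)[OF p] pendant_only[OF p] b'(1) b(1)] by simp
    moreover have "b \<notin> C" "(b, c) \<in> E" using alternating[OF b(1)] c symE[OF b(1)] by auto
    ultimately show ?thesis using connector_degree[of b c d c'] b b' by auto
  qed
  moreover have "(c, c') \<in> joined" using joinedI[OF c] b by auto
  ultimately have "{c'. (c, c') \<in> joined} = {c'}" by blast
  then show "card {c'. (c, c') \<in> joined} = 1" by simp
qed

lemma leaves_subdivided: "leaves subdivided = Inl ` {c. \<exists>p. pendant p c}"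
proof -
  have od: "out_degree (with_proj subdivided) v = card {e \<in> parcs subdivided. fst e = v}" for v
    by (simp add: out_degree_def out_arcs_def)
  have 1: "out_degree (with_proj subdivided) (Inl c) = card {c'. (c, c') \<in> joined}" for c
  proof -
    have "{e \<in> parcs subdivided. fst e = Inl c} = (\<lambda>c'. (Inl c, Inr {c, c'})) ` {c'. (c, c') \<in> joined}"
      unfolding subdivided_arcs by auto
    moreover have "inj_on (\<lambda>c'. (Inl c :: 'a + 'a set, Inr {c, c'} :: 'a + 'a set)) {c'. (c, c') \<in> joined}"
      by (auto simp: inj_on_def doubleton_eq_iff)
    ultimately show ?thesis unfolding od by (simp add: card_image)
  qed
  have 2: "out_degree (with_proj subdivided) (Inr {c, c'}) = 2" if cc: "(c, c') \<in> joined" for c c'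
  proof -
    have "(c', c) \<in> joined" using cc sym_joined by (meson symD)
    then have "{e \<in> parcs subdivided. fst e = Inr {c, c'}} = {(Inr {c, c'}, Inl c), (Inr {c, c'}, Inl c')}"
      using cc unfolding subdivided_arcs by (fastforce simp: doubleton_eq_iff insert_commute)
    moreover have "c \<noteq> c'" using cc by (auto simp: joined_def)
    ultimately show ?thesis unfolding od by simp
  qed
  have 3: "pendant p c \<Longrightarrow> c \<in> C" for p c by (simp add: pendant_def)
  show ?thesis
  proof (intro equalityI subsetI)
    fix x assume "x \<in> leaves subdivided"
    then have x: "x \<in> pverts subdivided" "out_degree (with_proj subdivided) x = 1"
      by (auto simp: leaves_def)
    from x(1) consider c where "x = Inl c" "c \<in> C" | c c' where "x = Inr {c, c'}" "(c, c') \<in> joined"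
      unfolding subdivided_verts by auto
    then show "x \<in> Inl ` {c. \<exists>p. pendant p c}"
      using x(2) 1 2 card_joined_eq_1 by cases auto
  next
    fix x :: "'a + 'a set" assume "x \<in> Inl ` {c. \<exists>p. pendant p c}"
    then obtain c p where c: "x = Inl c" "pendant p c" by blast
    then have "card {c'. (c, c') \<in> joined} = 1" using card_joined_eq_1 3 by blast
    then show "x \<in> leaves subdivided"
      using c 3 1 unfolding leaves_def subdivided_verts by auto
  qed
qed

abbreviation "special \<equiv> attach_pendants subdivided"

lemma special_verts:
  "pverts special = Inl ` Inl ` C \<union> (\<lambda>(u, v). Inl (Inr {u, v})) ` joined \<union> (\<lambda>c. Inr (Inl c)) ` {c. \<exists>p. pendant p c}"
proof -
  have 1: "pverts special = Inl ` pverts subdivided \<union> Inr ` leaves subdivided"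
    by (simp add: attach_pendants_def)
  have 2: "\<dots> = Inl ` (Inl ` C \<union> (\<lambda>(u, v). Inr {u, v}) ` joined) \<union> Inr ` Inl ` {c. \<exists>p. pendant p c}"
    by (simp only: subdivided_verts leaves_subdivided)
  show ?thesis unfolding 1 2
    by (simp only: image_Un image_image case_prod_unfold Un_assoc)
qed

lemma special_arcs:
  "e \<in> parcs special \<longleftrightarrow>
    (\<exists>c c'. (c, c') \<in> joined \<and> (e = (Inl (Inl c), Inl (Inr {c, c'})) \<or> e = (Inl (Inr {c, c'}), Inl (Inl c)))) \<or>
    (\<exists>c p. pendant p c \<and> (e = (Inl (Inl c), Inr (Inl c)) \<or> e = (Inr (Inl c), Inl (Inl c))))"
proof -
  have "parcs special = (\<Union>(c, c') \<in> joined. {(Inl (Inl c), Inl (Inr {c, c'})), (Inl (Inr {c, c'}), Inl (Inl c))})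
      \<union> (\<Union>c \<in> {c. \<exists>p. pendant p c}. {(Inl (Inl c), Inr (Inl c)), (Inr (Inl c), Inl (Inl c))})"
    unfolding attach_pendants_def subdivided_arcs leaves_subdivided
    by (simp add: image_UN case_prod_unfold)
  then show ?thesis by auto
qed

lemma joinedE:
  assumes "(c, c') \<in> joined"
  obtains b where "b \<in> V" "b \<notin> C" "c \<in> C" "c' \<in> C" "(b, c) \<in> E" "(b, c') \<in> E" "c \<noteq> c'"
  using assms alternating symE E_sub unfolding joined_def by blast

lemma embed_verts: "embed ` V = pverts special"
proof (intro equalityI subsetI)
  fix x assume "x \<in> embed ` V"
  then obtain v where x: "x = embed v" "v \<in> V" by auto
  from x(2) show "x \<in> pverts special"
  proof (cases rule: embed_cases)
    case 1
    then show ?thesis using x(1) unfolding special_verts by simp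
  next
    case (2 c c')
    then have "(c, c') \<in> joined" using joinedI[of c c' v] symE alternating by blast
    then show ?thesis using x(1) 2(5) unfolding special_verts by force
  next
    case (3 c)
    then show ?thesis using x(1) unfolding special_verts by blast
  qed
next
  fix x assume "x \<in> pverts special"
  then consider c where "c \<in> C" "x = Inl (Inl c)" | c c' where "(c, c') \<in> joined" "x = Inl (Inr {c, c'})"
    | c p where "pendant p c" "x = Inr (Inl c)"
    unfolding special_verts by auto
  then show "x \<in> embed ` V"
  proof cases
    case 1
    then show ?thesis using embed_cover C_sub by force
  next
    case (2 c c')
    then show ?thesis using embed_connector by (elim joinedE) (metis image_eqI)
  next
    case (3 c p)
    then have "p \<in> V" using E_sub pendantD(1) by blast
    then show ?thesis using embed_pendant[OF 3(1)] 3(2) by (metis image_eqI)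
  qed
qed

lemma sym_special: "(x, y) \<in> parcs special \<longleftrightarrow> (y, x) \<in> parcs special"
  unfolding special_arcs by auto

lemma embed_arcs: "map_prod embed embed ` E = parcs special"
proof (intro equalityI subsetI)
  have *: "(embed u, embed v) \<in> parcs special" if "(u, v) \<in> E" "u \<in> C" for u v
  proof -
    have v: "v \<in> V" "v \<notin> C" "(v, u) \<in> E" using that E_sub alternating symE by auto
    show ?thesis
    proof (cases "\<exists>c'. (v, c') \<in> E \<and> c' \<noteq> u")
      case True
      then obtain c' where "(v, c') \<in> E" "u \<noteq> c'" by auto
      then show ?thesis using embed_connector[OF v(2,3)] embed_cover[OF that(2)] joinedI[OF that(2) _ that(1)]
        unfolding special_arcs by auto
    next
      case False
      then have "pendant v u" using that by (auto simp: pendant_def)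
      then show ?thesis using embed_pendant embed_cover[OF that(2)] unfolding special_arcs by auto
    qed
  qed
  fix x assume "x \<in> map_prod embed embed ` E"
  then obtain u v where x: "x = (embed u, embed v)" "(u, v) \<in> E" by auto
  then show "x \<in> parcs special" using *[of u v] *[of v u] alternating symE sym_special by blast
next
  have *: "(x, y) \<in> map_prod embed embed ` E" if "(u, v) \<in> E" "x = embed u" "y = embed v" for x y u v
    using that by auto
  fix e assume "e \<in> parcs special"
  then consider c c' where "(c, c') \<in> joined" "e = (Inl (Inl c), Inl (Inr {c, c'})) \<or> e = (Inl (Inr {c, c'}), Inl (Inl c))"
    | c p where "pendant p c" "e = (Inl (Inl c), Inr (Inl c)) \<or> e = (Inr (Inl c), Inl (Inl c))"
    unfolding special_arcs by blast
  then show "e \<in> map_prod embed embed ` E"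
  proof cases
    case (1 c c')
    obtain b where b: "b \<notin> C" "c \<in> C" "(b, c) \<in> E" "(b, c') \<in> E" "c \<noteq> c'" using 1(1) by (rule joinedE)
    have "Inl (Inl c) = embed c" "Inl (Inr {c, c'}) = embed b"
      using embed_cover[OF b(2)] embed_connector[OF b(1,3,4,5)] by auto
    then show ?thesis using 1(2) *[OF b(3)] *[OF symE[OF b(3)]] by metis
  next
    case (2 c p)
    have cp: "(c, p) \<in> E" "c \<in> C" using pendantD[OF 2(1)] by auto
    have "Inl (Inl c) = embed c" "Inr (Inl c) = embed p"
      using embed_cover[OF cp(2)] embed_pendant[OF 2(1)] by auto
    then show ?thesis using 2(2) *[OF cp(1)] *[OF symE[OF cp(1)]] by metis
  qed
qed

section \<open>The skeleton is a tree, and the isomorphism\<close>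

lemma pair_graph_skeleton: "pair_graph skeleton"
proof
  show "finite (pverts skeleton)" using C_sub finite_V finite_subset by (auto simp: skeleton_def)
  have "joined \<subseteq> C \<times> C" by (rule joined_sub)
  moreover have "finite (C \<times> C)" using C_sub finite_V finite_subset by auto
  ultimately show "finite (parcs skeleton)" using finite_subset by (auto simp: skeleton_def)
  show "symmetric (with_proj skeleton)" using sym_joined by (simp add: symmetric_def skeleton_def)
qed (use joined_sub in \<open>auto simp: skeleton_def joined_def\<close>)

lemma conn_skeleton: "conn joined C"
proof -
  obtain x y where "(x, y) \<in> E" using E_ne by auto
  then have "C \<noteq> {}" using alternating[of x y] by auto
  moreover have "(c, w) \<in> joined\<^sup>*" if c: "c \<in> C" "w \<in> C" for c w
  proof -
    have "(c, w) \<in> E\<^sup>*" using c C_sub conn_E by (auto intro: conn_rtrancl)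
    \<comment> \<open>A walk in G is contracted to C: at a vertex outside C, the invariant is that
      all its neighbours are already reached in the skeleton.\<close>
    then have "(w \<in> C \<longrightarrow> (c, w) \<in> joined\<^sup>*) \<and> (w \<notin> C \<longrightarrow> (\<forall>p. (w, p) \<in> E \<longrightarrow> (c, p) \<in> joined\<^sup>*))"
    proof induction
      case (step y z)
      show ?case
      proof (cases "y \<in> C")
        case True
        have "(c, p) \<in> joined\<^sup>*" if "(z, p) \<in> E" for p
          using step True that joinedI[of y p z] by (cases "y = p") (auto intro: rtrancl_into_rtrancl)
        then show ?thesis using True alternating[OF step(2)] by blast
      next
        case False
        then show ?thesis using step alternating[OF step(2)] by blast
      qed
    qed (use c in auto)
    then show ?thesis using c by blast
  qed
  ultimately show ?thesis using conn_within[OF joined_sub] by blast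
qed

text \<open>Every other skeleton edge lifts to two steps through its own connector, which differs
  from b. A detour around cd would therefore lift and, preceded by bc, avoid the bridge bd.\<close>

lemma joined_bridge:
  assumes "(c, d) \<in> joined"
  shows "is_bridge joined c d"
proof -
  obtain b where b: "b \<notin> C" "(b, c) \<in> E" "(b, d) \<in> E" "c \<noteq> d" using assms by (rule joinedE)
  have lift: "(x, y) \<in> (del_edge E b d)\<^sup>*" if "(x, y) \<in> del_edge joined c d" for x y
  proof -
    have xy: "(x, y) \<in> joined" "(x, y) \<noteq> (c, d)" "(x, y) \<noteq> (d, c)" using that by (auto simp: del_edge_def)
    obtain b' where b': "b' \<notin> C" "(b', x) \<in> E" "(b', y) \<in> E" "x \<noteq> y" "x \<in> C" "y \<in> C"
      using xy(1) by (rule joinedE)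
    have "b' \<noteq> b"
      using connector_nbrs[OF b] connector_nbrs[OF b'(1-4)] xy(2,3) by (auto simp: doubleton_eq_iff)
    then have "(x, b') \<in> del_edge E b d" "(b', y) \<in> del_edge E b d"
      using b' b(1) symE by (auto simp: del_edge_def)
    then show ?thesis by (meson r_into_rtrancl rtrancl.rtrancl_into_rtrancl)
  qed
  have "(c, d) \<notin> (del_edge joined c d)\<^sup>*"
  proof
    assume "(c, d) \<in> (del_edge joined c d)\<^sup>*"
    moreover have "del_edge joined c d \<subseteq> (del_edge E b d)\<^sup>*" using lift by auto
    ultimately have "(c, d) \<in> (del_edge E b d)\<^sup>*" using rtrancl_subset_rtrancl by blast
    moreover have "(b, c) \<in> del_edge E b d"
      using b alternating[OF b(2)] by (auto simp: del_edge_def)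
    ultimately have "(b, d) \<in> (del_edge E b d)\<^sup>*" by (meson converse_rtrancl_into_rtrancl)
    then show False using bridges[OF b(3)] by (simp add: is_bridge_def)
  qed
  then show ?thesis by (simp add: is_bridge_def)
qed

lemma graph_tree_skeleton: "graph_tree skeleton"
  unfolding graph_tree_def
proof (intro conjI notI)
  show "pair_graph skeleton" by (rule pair_graph_skeleton)
  show "connected (with_proj skeleton)"
    using connected_with_proj_iff[of skeleton] sym_joined conn_skeleton by (simp add: skeleton_def)
  assume "\<exists>p. pre_digraph.cycle (with_proj skeleton) p \<and> length p \<ge> 3"
  then obtain u v where "(u, v) \<in> parcs skeleton" "\<not> is_bridge (parcs skeleton) u v"
    using cycle_imp_not_bridge[OF pair_graph_skeleton] by blast
  then show False using joined_bridge by (simp add: skeleton_def)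
qed

theorem special_treeI:
  assumes "pair_graph G" "pverts G = V" "parcs G = E"
  shows "special_tree G"
proof -
  interpret G: pair_graph G by fact
  define hom :: "('a, 'a \<times> 'a, ('a + 'a set) + ('a + 'a set), (('a + 'a set) + ('a + 'a set)) \<times> (('a + 'a set) + ('a + 'a set))) digraph_isomorphism"
    where "hom = \<lparr>iso_verts = embed, iso_arcs = map_prod embed embed, iso_head = snd, iso_tail = fst\<rparr>"
  have "inj_on (map_prod embed embed) (V \<times> V)" using inj_embed by (rule map_prod_inj_on) (rule inj_embed)
  then have "inj_on (map_prod embed embed) E" using E_sub by (rule inj_on_subset)
  then have "pre_digraph.digraph_isomorphism (with_proj G) hom"
    using inj_embed assms G.wf_digraph_axioms
    by (auto simp: pre_digraph.digraph_isomorphism_def hom_def)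
  moreover have "with_proj special = app_iso hom (with_proj G)"
    using assms embed_verts embed_arcs by (simp add: app_iso_def with_proj_def hom_def)
  ultimately show ?thesis
    unfolding special_tree_def digraph_iso_def using graph_tree_skeleton by blast
qed

end

section \<open>Strongly critical graphs are connected\<close>

lemma arcs_ends_fst_snd: "tail H = fst \<Longrightarrow> head H = snd \<Longrightarrow> arcs_ends H = arcs H"
  by (auto simp: arcs_ends_def arc_to_ends_def)

text \<open>In a symmetric digraph reachability is an equivalence, and the strong components are its
  classes.\<close>

lemma sccs_verts_iff:
  fixes H :: "('a, 'a \<times> 'a) pre_digraph"
  assumes "tail H = fst" "head H = snd" "sym (arcs H)" "arcs H \<subseteq> verts H \<times> verts H"
  shows "S \<in> pre_digraph.sccs_verts H \<longleftrightarrow> (\<exists>u\<in>verts H. S = {v. (u, v) \<in> (arcs H)\<^sup>*})"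
proof -
  have "arcs H \<inter> verts H \<times> verts H = arcs H" using assms(4) by auto
  then have r: "reachable H u v \<longleftrightarrow> u \<in> verts H \<and> (u, v) \<in> (arcs H)\<^sup>*" for u v
    using arcs_ends_fst_snd[OF assms(1,2)] by (simp add: reachable_def rtrancl_on_iff)
  have sym: "(v, u) \<in> (arcs H)\<^sup>*" if "(u, v) \<in> (arcs H)\<^sup>*" for u v
    using that assms(3) by (meson sym_rtrancl symD)
  have closed: "v \<in> verts H" if "(u, v) \<in> (arcs H)\<^sup>*" "u \<in> verts H" for u v
    using that by (induction) (use assms(4) in auto)
  show ?thesis
  proof
    assume S: "S \<in> pre_digraph.sccs_verts H"
    then obtain u where u: "u \<in> S" by (auto simp: pre_digraph.sccs_verts_def)
    then have uV: "u \<in> verts H" using S r by (auto simp: pre_digraph.sccs_verts_def)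
    have "S = {v. (u, v) \<in> (arcs H)\<^sup>*}"
    proof (intro equalityI subsetI)
      fix v assume "v \<in> S"
      then show "v \<in> {v. (u, v) \<in> (arcs H)\<^sup>*}" using S u r by (auto simp: pre_digraph.sccs_verts_def)
    next
      fix v assume "v \<in> {v. (u, v) \<in> (arcs H)\<^sup>*}"
      then have "reachable H u v" "reachable H v u" using r uV sym closed by auto
      then show "v \<in> S" using S u unfolding pre_digraph.sccs_verts_def by blast
    qed
    then show "\<exists>u\<in>verts H. S = {v. (u, v) \<in> (arcs H)\<^sup>*}" using uV by blast
  next
    assume "\<exists>u\<in>verts H. S = {v. (u, v) \<in> (arcs H)\<^sup>*}"
    then obtain u where u: "u \<in> verts H" "S = {v. (u, v) \<in> (arcs H)\<^sup>*}" by blast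
    have "reachable H a b" if "a \<in> S" "b \<in> S" for a b
      using that u(2) closed[OF _ u(1)] rtrancl_trans[OF sym] unfolding r by blast
    moreover have "b \<in> S" if "a \<in> S" "reachable H a b" for a b
      using that u r by (auto intro: rtrancl_trans)
    moreover have "S \<noteq> {}" using u by auto
    ultimately show "S \<in> pre_digraph.sccs_verts H" unfolding pre_digraph.sccs_verts_def by blast
  qed
qed

lemma vertex_cover_iff: "vertex_cover G C \<longleftrightarrow> C \<subseteq> pverts G \<and> covers (parcs G) C"
  by (auto simp: vertex_cover_def covers_def)

section \<open>Cover numbers, subgraphs and prices of finite simple graphs\<close>

context pair_graph
begin

lemma parcs_sub: "parcs G \<subseteq> pverts G \<times> pverts G"
  using in_arcsD1 in_arcsD2 by auto

lemma sym_parcs: "sym (parcs G)"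
  using sym_arcs by (simp add: symmetric_def)

lemma connected_vertex_cover_iff:
  assumes "conn (parcs G) (pverts G)"
  shows "connected_vertex_cover G C \<longleftrightarrow> C \<subseteq> pverts G \<and> covers (parcs G) C \<and> conn (parcs G) C"
  using assms unfolding connected_vertex_cover_def
  by (simp add: vertex_cover_iff connected_with_proj_iff[OF sym_parcs] connected_induce_iff[OF sym_parcs])

lemma finite_vertex_cover: "finite {C. vertex_cover G C}"
  by (rule finite_subset[of _ "Pow (pverts G)"]) (auto simp: vertex_cover_def)

lemma finite_connected_vertex_cover: "finite {C. connected_vertex_cover G C}"
  by (rule finite_subset[OF _ finite_vertex_cover]) (auto simp: connected_vertex_cover_def)

lemma vc_number_le: "vertex_cover G C \<Longrightarrow> vc_number G \<le> card C"
  unfolding vc_number_def using finite_vertex_cover by (intro Min_le) auto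

lemma connected_vc_number_le: "connected_vertex_cover G C \<Longrightarrow> connected_vc_number G \<le> card C"
  unfolding connected_vc_number_def using finite_connected_vertex_cover by (intro Min_le) auto

lemma vc_number_ex: "\<exists>C. vertex_cover G C \<and> card C = vc_number G"
proof -
  have "vertex_cover G (pverts G)" using parcs_sub by (auto simp: vertex_cover_def)
  then have "vc_number G \<in> card ` {C. vertex_cover G C}"
    unfolding vc_number_def using finite_vertex_cover by (intro Min_in) auto
  then show ?thesis by auto
qed

lemma connected_vc_number_ex:
  assumes "conn (parcs G) (pverts G)"
  shows "\<exists>C. connected_vertex_cover G C \<and> card C = connected_vc_number G"
proof -
  have "covers (parcs G) (pverts G)" using parcs_sub by (auto simp: covers_def)
  then have "connected_vertex_cover G (pverts G)" using connected_vertex_cover_iff assms by simp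
  then have "connected_vc_number G \<in> card ` {C. connected_vertex_cover G C}"
    unfolding connected_vc_number_def using finite_connected_vertex_cover by (intro Min_in) auto
  then show ?thesis by auto
qed

lemma vc_number_pos:
  assumes "parcs G \<noteq> {}"
  shows "0 < vc_number G"
proof (rule ccontr)
  assume "\<not> ?thesis"
  then obtain C where C: "C \<subseteq> pverts G" "covers (parcs G) C" "card C = 0"
    using vc_number_ex unfolding vertex_cover_iff by auto
  moreover have "finite C" using finite_subset[OF C(1)] finite_verts by simp
  ultimately have "C = {}" by simp
  then show False using assms C(2) by (auto simp: covers_def)
qed

lemma sub_pair_graph:
  assumes "V' \<subseteq> pverts G" "E' \<subseteq> parcs G" "E' \<subseteq> V' \<times> V'" "sym E'"
  shows "pair_graph \<lparr>pverts = V', parcs = E'\<rparr>"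
    and "subgraph (with_proj \<lparr>pverts = V', parcs = E'\<rparr>) (with_proj G)"
proof -
  show H: "pair_graph \<lparr>pverts = V', parcs = E'\<rparr>"
  proof
    show "finite (pverts \<lparr>pverts = V', parcs = E'\<rparr>)" "finite (parcs \<lparr>pverts = V', parcs = E'\<rparr>)"
      using finite_subset[OF assms(1)] finite_subset[OF assms(2)] finite_verts finite_arcs by auto
    show "symmetric (with_proj \<lparr>pverts = V', parcs = E'\<rparr>)" using assms(4) by (simp add: symmetric_def)
    show "\<And>e. e \<in> parcs \<lparr>pverts = V', parcs = E'\<rparr> \<Longrightarrow> fst e \<noteq> snd e" using assms(2) no_loops' by auto
  qed (use assms in auto)
  interpret H: pair_graph "\<lparr>pverts = V', parcs = E'\<rparr>" by (rule H)
  show "subgraph (with_proj \<lparr>pverts = V', parcs = E'\<rparr>) (with_proj G)"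
    using assms wf_digraph_axioms H.wf_digraph_axioms by (auto simp: subgraph_def compatible_def)
qed

lemma critical_sub:
  assumes "strongly_critical G" "V' \<subseteq> pverts G" "E' \<subseteq> parcs G" "E' \<subseteq> V' \<times> V'" "sym E'"
    and conn: "conn E' V'" and ne: "E' \<noteq> {}" and proper: "\<lparr>pverts = V', parcs = E'\<rparr> \<noteq> G"
  shows "\<exists>D\<subseteq>V'. covers E' D \<and> conn E' D \<and>
      card D * vc_number G < connected_vc_number G * vc_number \<lparr>pverts = V', parcs = E'\<rparr>"
proof -
  let ?H = "\<lparr>pverts = V', parcs = E'\<rparr>"
  note H = sub_pair_graph[OF assms(2-5)]
  interpret H: pair_graph ?H by (rule H(1))
  have pr: "price_of_connectivity ?H < price_of_connectivity G"
    using assms(1) H ne proper unfolding strongly_critical_def by auto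
  have "0 < vc_number ?H" using H.vc_number_pos ne by simp
  moreover have "0 < vc_number G" using vc_number_pos assms(1) by (simp add: strongly_critical_def)
  ultimately have "real (connected_vc_number ?H) * real (vc_number G)
      < real (connected_vc_number G) * real (vc_number ?H)"
    using pr unfolding price_of_connectivity_def by (simp add: field_simps)
  then have "connected_vc_number ?H * vc_number G < connected_vc_number G * vc_number ?H"
    by (metis of_nat_less_iff of_nat_mult)
  moreover obtain D where "connected_vertex_cover ?H D" "card D = connected_vc_number ?H"
    using H.connected_vc_number_ex conn by auto
  ultimately show ?thesis using H.connected_vertex_cover_iff conn by auto
qed

text \<open>The price of a disconnected graph is at most the largest price of its components, by averaging.\<close>

lemma strongly_critical_conn:
  assumes crit: "strongly_critical G"
  shows "conn (parcs G) (pverts G)"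
proof (rule ccontr)
  assume nc: "\<not> ?thesis"
  let ?E = "parcs G" and ?V = "pverts G"
  define cls where "cls u = {v. (u, v) \<in> ?E\<^sup>*}" for u
  \<comment> \<open>These are the components that \<open>connected_vertex_cover\<close> counts for a
    disconnected graph.\<close>
  define KK where "KK = {K \<in> graph_components (with_proj G). \<exists>(u, v) \<in> ?E. u \<in> K \<and> v \<in> K}"
  have comp: "K \<in> graph_components (with_proj G) \<longleftrightarrow> (\<exists>u\<in>?V. K = cls u)" for K
    using sccs_verts_iff[of "with_proj G" K] sym_parcs parcs_sub by (simp add: cls_def)
  have sym: "(v, u) \<in> ?E\<^sup>*" if "(u, v) \<in> ?E\<^sup>*" for u v
    using that sym_parcs by (meson sym_rtrancl symD)
  have cls_eq: "cls u = cls v" if "(u, v) \<in> ?E\<^sup>*" for u v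
    using that sym unfolding cls_def by (auto intro: rtrancl_trans)
  have KK_cls: "K = cls u" if K: "K \<in> KK" "u \<in> K" for K u
  proof -
    obtain w where w: "K = cls w" using K(1) comp by (auto simp: KK_def)
    then have "(w, u) \<in> ?E\<^sup>*" using K(2) by (simp add: cls_def)
    then show ?thesis using cls_eq w by simp
  qed
  have cls_KK: "cls u \<in> KK" if "(u, v) \<in> ?E" for u v
    using that comp parcs_sub unfolding KK_def cls_def by blast
  have KK_sub: "K \<subseteq> ?V" if K: "K \<in> KK" for K
  proof
    fix v assume v: "v \<in> K"
    obtain w where "w \<in> ?V" "K = cls w" using K comp by (auto simp: KK_def)
    then have "(w, v) \<in> ?E\<^sup>*" "w \<in> ?V" using v by (auto simp: cls_def)
    then show "v \<in> ?V" by (induction) (use parcs_sub in auto)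
  qed
  have disj: "K \<inter> L = {}" if "K \<in> KK" "L \<in> KK" "K \<noteq> L" for K L
    using KK_cls that by blast
  have finKK: "finite KK" using KK_sub finite_verts finite_subset[of KK "Pow ?V"] by auto
  define sub where "sub K = \<lparr>pverts = K, parcs = ?E \<inter> K \<times> K\<rparr>" for K
  have "\<exists>D. D \<subseteq> K \<and> covers (?E \<inter> K \<times> K) D \<and> conn ?E D \<and>
      card D * vc_number G < connected_vc_number G * vc_number (sub K)" if K: "K \<in> KK" for K
  proof -
    have cK: "conn ?E K" using K comp conn_reachable_set[OF sym_parcs] by (auto simp: KK_def cls_def)
    then have cK': "conn (?E \<inter> K \<times> K) K" by (rule conn_mono) auto
    moreover have "sym (?E \<inter> K \<times> K)" using sym_parcs by (auto simp: sym_def)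
    moreover have "?E \<inter> K \<times> K \<noteq> {}" using K by (auto simp: KK_def)
    \<comment> \<open>K is connected and G is not, so criticality applies to each component.\<close>
    moreover have "sub K \<noteq> G" using nc cK unfolding sub_def by (metis pair_pre_digraph.select_convs(1))
    ultimately obtain D where D: "D \<subseteq> K" "covers (?E \<inter> K \<times> K) D" "conn (?E \<inter> K \<times> K) D"
      "card D * vc_number G < connected_vc_number G * vc_number (sub K)"
      using critical_sub[OF crit KK_sub[OF K], of "?E \<inter> K \<times> K"] unfolding sub_def by auto
    moreover have "conn ?E D" using D(3) by (rule conn_mono) auto
    ultimately show ?thesis by blast
  qed
  then obtain D where D: "\<And>K. K \<in> KK \<Longrightarrow> D K \<subseteq> K" "\<And>K. K \<in> KK \<Longrightarrow> covers (?E \<inter> K \<times> K) (D K)"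
    "\<And>K. K \<in> KK \<Longrightarrow> conn ?E (D K)"
    "\<And>K. K \<in> KK \<Longrightarrow> card (D K) * vc_number G < connected_vc_number G * vc_number (sub K)"
    by metis
  define DD where "DD = (\<Union>K\<in>KK. D K)"
  have DD_sub: "DD \<subseteq> ?V" using D(1) KK_sub unfolding DD_def by blast
  have cov: "covers ?E DD"
  proof (rule coversI)
    fix u v assume uv: "(u, v) \<in> ?E" "u \<notin> DD"
    have "(u, v) \<in> ?E \<inter> cls u \<times> cls u" using uv by (auto simp: cls_def)
    then show "v \<in> DD" using D(2)[OF cls_KK[OF uv(1)]] uv cls_KK[OF uv(1)] unfolding DD_def covers_def by blast
  qed
  have DDK: "v \<in> D K" if v: "v \<in> DD" "v \<in> K" "K \<in> KK" for v K
  proof -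
    obtain L where "L \<in> KK" "v \<in> D L" using v(1) by (auto simp: DD_def)
    then show ?thesis using v D(1) disj by blast
  qed
  let ?R = "?E \<inter> DD \<times> DD"
  have cls_DD: "{v. (u, v) \<in> ?R\<^sup>*} = D K" if K: "K \<in> KK" "u \<in> D K" for u K
  proof (intro equalityI subsetI)
    fix v assume "v \<in> D K"
    then have "(u, v) \<in> (?E \<inter> D K \<times> D K)\<^sup>*" using D(3) K by (auto intro: connD)
    moreover have "?E \<inter> D K \<times> D K \<subseteq> ?R" using K by (auto simp: DD_def)
    ultimately show "v \<in> {v. (u, v) \<in> ?R\<^sup>*}" using rtrancl_mono by blast
  next
    fix v assume v: "v \<in> {v. (u, v) \<in> ?R\<^sup>*}"
    have "u \<in> DD" using K by (auto simp: DD_def)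
    then have "v \<in> DD" using v by (auto elim: rtranclE)
    moreover have "(u, v) \<in> ?E\<^sup>*" using v rtrancl_mono[of ?R ?E] by auto
    then have "v \<in> K" using KK_cls[of K u] D(1) K by (auto simp: cls_def)
    ultimately show "v \<in> D K" using DDK K by blast
  qed
  \<comment> \<open>The union of the D K has exactly one component per member of \<open>KK\<close>,
    which is what makes it a connected cover of G.\<close>
  have "graph_components (with_proj G \<restriction> DD) = D ` KK"
  proof (intro equalityI subsetI)
    have arcs: "arcs (with_proj G \<restriction> DD) = ?R" by auto
    have symR: "sym ?R" using sym_parcs by (auto simp: sym_def)
    have iff: "S \<in> graph_components (with_proj G \<restriction> DD) \<longleftrightarrow> (\<exists>u\<in>DD. S = {v. (u, v) \<in> ?R\<^sup>*})" for S
      using sccs_verts_iff[of "with_proj G \<restriction> DD" S] arcs symR by auto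
    fix S
    show "S \<in> D ` KK" if "S \<in> graph_components (with_proj G \<restriction> DD)"
    proof -
      obtain u where u: "u \<in> DD" "S = {v. (u, v) \<in> ?R\<^sup>*}" using \<open>S \<in> _\<close> iff by blast
      then obtain K where "K \<in> KK" "u \<in> D K" by (auto simp: DD_def)
      then show ?thesis using cls_DD u by blast
    qed
    show "S \<in> graph_components (with_proj G \<restriction> DD)" if "S \<in> D ` KK"
    proof -
      obtain K where K: "K \<in> KK" "S = D K" using \<open>S \<in> D ` KK\<close> by blast
      then obtain u where "u \<in> D K" using D(3)[OF K(1)] by (auto simp: conn_def)
      then show ?thesis using iff cls_DD[OF K(1)] K unfolding DD_def by blast
    qed
  qed
  moreover have "inj_on D KK"
  proof (rule inj_onI)
    fix K L assume "K \<in> KK" "L \<in> KK" "D K = D L"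
    then show "K = L" using D(1)[of K] D(1)[of L] D(3)[of K] disj[of K L] unfolding conn_def by blast
  qed
  ultimately have "card (graph_components (with_proj G \<restriction> DD)) = card KK" by (simp add: card_image)
  then have "connected_vertex_cover G DD"
    using nc cov DD_sub connected_with_proj_iff[OF sym_parcs]
    by (simp add: connected_vertex_cover_def vertex_cover_iff KK_def)
  then have "connected_vc_number G \<le> card DD" by (rule connected_vc_number_le)
  also have "\<dots> \<le> (\<Sum>K\<in>KK. card (D K))" unfolding DD_def by (rule card_UN_le[OF finKK])
  \<comment> \<open>With \<kappa> and \<tau> for the two numbers of G, the chain is \<kappa>\<tau>
    \<le> \<Sum>|D K|\<tau> < \<kappa>\<Sum>\<tau>(K) \<le> \<kappa>\<tau>. The last step restricts
    a minimum cover of G to the disjoint components.\<close>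
  finally have "connected_vc_number G * vc_number G \<le> (\<Sum>K\<in>KK. card (D K) * vc_number G)"
    by (simp add: sum_distrib_right[symmetric])
  also have "\<dots> < (\<Sum>K\<in>KK. connected_vc_number G * vc_number (sub K))"
  proof (rule sum_strict_mono[OF finKK])
    obtain u v where "(u, v) \<in> ?E" using crit by (auto simp: strongly_critical_def)
    then show "KK \<noteq> {}" using cls_KK by blast
  qed (rule D(4))
  also have "\<dots> = connected_vc_number G * (\<Sum>K\<in>KK. vc_number (sub K))" by (simp add: sum_distrib_left)
  also have "\<dots> \<le> connected_vc_number G * vc_number G"
  proof (rule mult_le_mono2)
    obtain C where C: "C \<subseteq> ?V" "covers ?E C" "card C = vc_number G"
      using vc_number_ex unfolding vertex_cover_iff by auto
    have finC: "finite C" using finite_subset[OF C(1)] finite_verts by simp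
    have "vc_number (sub K) \<le> card (C \<inter> K)" if K: "K \<in> KK" for K
    proof -
      have "sym (?E \<inter> K \<times> K)" using sym_parcs by (auto simp: sym_def)
      then interpret H: pair_graph "sub K"
        unfolding sub_def by (intro sub_pair_graph KK_sub[OF K]) auto
      have "covers (?E \<inter> K \<times> K) (C \<inter> K)" using C(2) by (auto simp: covers_def)
      then show ?thesis by (intro H.vc_number_le) (auto simp: vertex_cover_iff sub_def)
    qed
    then have "(\<Sum>K\<in>KK. vc_number (sub K)) \<le> (\<Sum>K\<in>KK. card (C \<inter> K))" by (rule sum_mono)
    also have "\<dots> = card (\<Union>K\<in>KK. C \<inter> K)"
      using finKK finC disj by (intro card_UN_disjoint[symmetric]) auto
    also have "\<dots> \<le> card C" using finC by (intro card_mono) auto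
    finally show "(\<Sum>K\<in>KK. vc_number (sub K)) \<le> vc_number G" using C(3) by simp
  qed
  finally show False by simp
qed

lemma critical_graph_of_strongly_critical:
  assumes crit: "strongly_critical G"
  shows "critical_graph (pverts G) (parcs G) (vc_number G) (connected_vc_number G)"
proof
  note conn = strongly_critical_conn[OF crit]
  show "conn (parcs G) (pverts G)" by (rule conn)
  show "finite (pverts G)" using finite_verts by simp
  show "parcs G \<subseteq> pverts G \<times> pverts G" by (rule parcs_sub)
  show "sym (parcs G)" by (rule sym_parcs)
  show "(u, u) \<notin> parcs G" for u using no_loops' by force
  show "parcs G \<noteq> {}" using crit by (simp add: strongly_critical_def)
  show "vc_number G \<le> card C" if "C \<subseteq> pverts G" "covers (parcs G) C" for C
    using that by (intro vc_number_le) (simp add: vertex_cover_iff)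
  show "\<exists>C\<subseteq>pverts G. covers (parcs G) C \<and> card C = vc_number G"
    using vc_number_ex unfolding vertex_cover_iff by auto
  show "connected_vc_number G \<le> card D" if "D \<subseteq> pverts G" "covers (parcs G) D" "conn (parcs G) D" for D
    using that by (intro connected_vc_number_le) (simp add: connected_vertex_cover_iff[OF conn])
  show "\<exists>D\<subseteq>pverts G. covers (parcs G) D \<and> conn (parcs G) D \<and> card D = connected_vc_number G"
    using connected_vc_number_ex[OF conn] unfolding connected_vertex_cover_iff[OF conn] by auto
  fix V' E' C
  assume H: "V' \<subseteq> pverts G" "E' \<subseteq> parcs G" "E' \<subseteq> V' \<times> V'" "sym E'" "conn E' V'" "E' \<noteq> {}" "E' \<noteq> parcs G"
    and C: "C \<subseteq> V'" "covers E' C"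
  let ?H = "\<lparr>pverts = V', parcs = E'\<rparr>"
  interpret H: pair_graph ?H using sub_pair_graph[OF H(1-4)] by blast
  have "?H \<noteq> G" using H(7) by (metis pair_pre_digraph.select_convs(2))
  then obtain D where D: "D \<subseteq> V'" "covers E' D" "conn E' D"
    "card D * vc_number G < connected_vc_number G * vc_number ?H"
    using critical_sub[OF crit H(1-6)] by blast
  have "vc_number ?H \<le> card C" using C by (intro H.vc_number_le) (simp add: vertex_cover_iff)
  then have "connected_vc_number G * vc_number ?H \<le> connected_vc_number G * card C" by (rule mult_le_mono2)
  then show "\<exists>D\<subseteq>V'. covers E' D \<and> conn E' D \<and> card D * vc_number G < connected_vc_number G * card C"
    using D by (meson order_less_le_trans)
qed

end

section \<open>Both parts for strongly critical graphs\<close>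

theorem theorem6:
  fixes G :: "'a pair_pre_digraph"
  assumes "pair_graph G" and "strongly_critical G"
  shows "(\<forall>C. minimum_vertex_cover G C \<longrightarrow> independent_set G C) \<and> bipartite G
    \<and> ((\<exists>v. cutvertex G v) \<longrightarrow> special_tree G)"
proof (intro conjI allI impI)
  interpret pair_graph G by fact
  interpret crit: critical_graph "pverts G" "parcs G" "vc_number G" "connected_vc_number G"
    by (rule critical_graph_of_strongly_critical[OF assms(2)])
  have indep: "independent_set G C" if "minimum_vertex_cover G C" for C
    using that crit.min_cover_independent[of C]
    by (auto simp: minimum_vertex_cover_def independent_set_def vertex_cover_iff)
  then show "independent_set G C" if "minimum_vertex_cover G C" for C using that .
  show "bipartite G"
  proof -
    obtain C where C: "vertex_cover G C" "card C = vc_number G" using vc_number_ex by blast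
    then have "independent_set G C" using indep by (simp add: minimum_vertex_cover_def)
    moreover have "independent_set G (pverts G - C)"
      using C(1) by (auto simp: independent_set_def vertex_cover_def)
    moreover have "C \<union> (pverts G - C) = pverts G" using C(1) by (auto simp: vertex_cover_def)
    ultimately show ?thesis unfolding bipartite_def by (meson Diff_disjoint)
  qed
  assume "\<exists>v. cutvertex G v"
  then obtain v where v: "cutvertex G v" ..
  \<comment> \<open>If v did not separate, G - v would have at most one component while G has at
    least one, so their number would not increase.\<close>
  have sep: "crit.separates v"
  proof (rule ccontr)
    assume ns: "\<not> crit.separates v"
    let ?V = "pverts G - {v}"
    let ?H = "pre_digraph.del_vert (with_proj G) v"
    let ?R = "parcs G \<inter> ?V \<times> ?V"
    have vV: "v \<in> pverts G" using v by (simp add: cutvertex_def)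
    have H: "verts ?H = ?V" "arcs ?H = ?R" "tail ?H = fst" "head ?H = snd"
      using parcs_sub by (auto simp: pre_digraph.del_vert_def)
    have "sym ?R" using sym_parcs by (auto simp: sym_def)
    then have iff: "S \<in> graph_components ?H \<longleftrightarrow> (\<exists>u\<in>?V. S = {w. (u, w) \<in> ?R\<^sup>*})" for S
      using sccs_verts_iff[of ?H S] H by simp
    have reach: "(a, b) \<in> ?R\<^sup>* \<longleftrightarrow> b \<in> ?V" if "a \<in> ?V" for a b
      using that ns vV unfolding crit.separates_def by (auto elim: rtranclE)
    have "graph_components ?H \<subseteq> {?V}"
      using iff reach by auto
    then have "card (graph_components ?H) \<le> card {?V}" by (intro card_mono) auto
    moreover have "scc_of v \<in> graph_components (with_proj G)" using vV by (intro scc_of_in_sccs_verts) simp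
    then have "card (graph_components (with_proj G)) \<noteq> 0" using finite_sccs_verts by auto
    ultimately show False using v by (simp add: cutvertex_def)
  qed
  interpret crit: critical_tree "pverts G" "parcs G" "vc_number G" "connected_vc_number G"
    by unfold_locales (use crit.all_bridges[OF sep] crit.separates_inner[OF sep] in auto)
  obtain C where C: "C \<subseteq> crit.inner" "covers (parcs G) C" "card C = vc_number G"
    by (rule crit.inner_min_cover)
  have CV: "C \<subseteq> pverts G" using C(1) crit.inner_sub by auto
  \<comment> \<open>By part (i) C is independent, and it is a cover, so every edge has exactly one
    end in C. The other conditions come from \<open>critical_tree\<close>.\<close>
  interpret subdivided_tree "pverts G" "parcs G" C
  proof
    show "finite (pverts G)" "parcs G \<subseteq> pverts G \<times> pverts G" "sym (parcs G)"
      "conn (parcs G) (pverts G)" "parcs G \<noteq> {}"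
      using crit.finite_V crit.E_sub crit.sym_E crit.conn_E crit.E_ne by auto
    show "C \<subseteq> pverts G" by (rule CV)
    show "is_bridge (parcs G) x y" if "(x, y) \<in> parcs G" for x y using crit.bridges that .
    show "u \<in> C \<longleftrightarrow> v \<notin> C" if "(u, v) \<in> parcs G" for u v
      using crit.min_cover_independent[OF CV C(2,3) that] C(2) that by (auto simp: covers_def)
    show "c1 = c2" if "b \<notin> C" "(b, c) \<in> parcs G" "(b, c1) \<in> parcs G" "(b, c2) \<in> parcs G" "c1 \<noteq> c" "c2 \<noteq> c"
      for b c c1 c2 using crit.connector_degree[OF CV C(2,3) that] .
    show "\<exists>s t. s \<noteq> t \<and> (c, s) \<in> parcs G \<and> (c, t) \<in> parcs G" if "c \<in> C" for c
      using that C(1) by (auto simp: crit.inner_def)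
    show "s = t" if "c \<in> C" "(c, p) \<in> parcs G" "\<And>u. (p, u) \<in> parcs G \<Longrightarrow> u = c"
      "(c, s) \<in> parcs G" "(c, t) \<in> parcs G" "s \<noteq> p" "t \<noteq> p" for c p s t
    proof (rule crit.pendant_nbr_degree[OF C that(2) _ that(4-7)])
      show "p \<notin> crit.inner" using that(3) unfolding crit.inner_def by blast
    qed
    show "\<exists>b c'. (c, b) \<in> parcs G \<and> (b, c') \<in> parcs G \<and> c' \<noteq> c" if "c \<in> C" for c
      using crit.cover_vertex_inner_nbr[OF C that] unfolding crit.inner_def by blast
  qed
  show "special_tree G" using special_treeI assms(1) by simp
qed

end
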